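(* Let $k$ be the ground field. For $(\alpha:\beta)\in\mathbf{P}^1(k)$ let $$W(\alpha,\beta)=\Big(\bigoplus_{l\ge1}k\,z^{-l}\Big)\oplus k\,(\alpha+\beta z)\subset V=k((z)),$$ so that $R=\{W(\alpha,\beta)\}$ is a projective line in $Gr_0(V)$ with coordinates $(\alpha:\beta)$. Then, under the embedding $\gamma^{-1}:Gr_0(V)\to\mathcal{E}_K^{(0)}$, the coordinates $a_{-1,1}$ and $a_{0,1}$ of $\gamma^{-1}(W(\alpha,\beta))$ are $$a_{-1,1}=\begin{cases}0,&\alpha\ne0\\ -1,&\alpha=0\end{cases}\qquad\qquad a_{0,1}=\begin{cases}-\beta/\alpha,&\alpha\ne0\\ 0,&\alpha=0.\end{cases}$$ These functions on the projective line $R$ are not continuous. Hence the embedding $\gamma^{-1}$ of the universal Sato Grassmannian into the affine space $\mathcal{E}_K^{(0)}$ is only a set-theoretic map.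
   Context: $V=k((z))$. $Gr_0(V)$ is the set of $k$-subspaces $W\subset V$ for which the map $W\oplus zk[[z]]\to V$ has finite-dimensional kernel and cokernel of equal dimension (Fredholm with Euler characteristic $0$); it is the zero component of the universal Sato Grassmannian. Put $W_0=k[z^{-1}]=\bigoplus_{l\ge0}k z^{-l}\in Gr_0(V)$. $P=k((x))((\partial^{-1}))$ is the skew field of formal pseudo-differential operators $\sum_{i\le n}a_i\partial^i$, $a_i\in K:=k((x))$, with multiplication given by the Leibniz rule ($\partial a=a\partial+a'$). $E=k[[x]]((\partial^{-1}))\subset P$ is the subring of operators with coefficients in $k[[x]]$. The quotient $E/Ex$ is identified with $V$ by sending the class of $\partial^{-1}$ to $z$ (so the class of $\partial^{-i}$ goes to $z^i$ for all $i\in\mathbb{Z}$). This gives a linear action of $E$ on $V$. $\mathcal{E}^{(0)}_K\subset P$ is the group of monic (leading coefficient $1$) operators of degree zero, i.e. operators $1+\sum_{i,j}a_{ij}x^i\partial^{-j}$ with $j\ge1$, $i\in\mathbb{Z}$. The $a_{ij}\in k$ are the coordinates on $\mathcal{E}_K^{(0)}$, regarded as an infinite-dimensional affine space (more correctly, an inductive limit of infinite-dimensional affine spaces). An operator $S\in\mathcal{E}^{(0)}_K$ is quasiregular if there are $m,n\in\mathbb{N}$ with $x^mS\in E$ and $S^{-1}x^n\in E$; $\mathcal{R}$ denotes the set of quasiregular operators. The map $\gamma:\mathcal{R}\to Gr_0(V)$, $\gamma(S)=(S^{-1}x^n)W_0$, does not depend on $n$ (because $xW_0=W_0$) and, by a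 known theorem, is a bijection. Thus $\gamma^{-1}$ embeds $Gr_0(V)$ into $\mathcal{E}_K^{(0)}$. *)

theory Defs
  imports
    "HOL-Analysis.Analysis"
    "HOL-Computational_Algebra.Computational_Algebra"
    "HOL-Library.Product_Plus"
begin

section \<open>Formal pseudo-differential operators\<close>

text \<open>
  An operator \<open>\<Sum>i\<le>n. a\<^sub>i \<partial>\<^sup>i\<close> with \<open>a\<^sub>i \<in> k((x))\<close> is its coefficient function \<open>i \<mapsto> a\<^sub>i\<close>.
  The coefficients are written on the left of the powers of \<open>\<partial>\<close>.
\<close>

typedef (overloaded) 'k psdo = "{c :: int \<Rightarrow> 'k::zero fls. \<exists>n. \<forall>i>n. c i = 0}"
  morphisms psdo_coeff Abs_psdo
  by (rule exI[of _ "\<lambda>_. 0"]) simp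

text \<open>
  The Leibniz rule \<open>\<partial> a = a \<partial> + a'\<close> yields
  \<open>a \<partial>\<^sup>i \<cdot> b \<partial>\<^sup>j = (\<Sum>l\<ge>0. (i choose l) a b\<^sup>(\<^sup>l\<^sup>) \<partial>\<^sup>i\<^sup>+\<^sup>j\<^sup>-\<^sup>l)\<close> for all integers \<open>i\<close>, \<open>j\<close>.
  Only finitely many terms contribute to the coefficient of a given \<open>\<partial>\<^sup>m\<close>
  (lemma \<open>finite_psdo_times_support\<close> below), so that the sum over all of them is a genuine one.
\<close>

instantiation psdo :: (field_char_0) "{zero, one, plus, minus, times}"
begin

definition zero_psdo :: "'a psdo" where
  "0 = Abs_psdo (\<lambda>_. 0)"

definition one_psdo :: "'a psdo" where
  "1 = Abs_psdo (\<lambda>i. if i = 0 then 1 else 0)"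

definition plus_psdo :: "'a psdo \<Rightarrow> 'a psdo \<Rightarrow> 'a psdo" where
  "P + Q = Abs_psdo (\<lambda>i. psdo_coeff P i + psdo_coeff Q i)"

definition minus_psdo :: "'a psdo \<Rightarrow> 'a psdo \<Rightarrow> 'a psdo" where
  "P - Q = Abs_psdo (\<lambda>i. psdo_coeff P i - psdo_coeff Q i)"

definition times_psdo :: "'a psdo \<Rightarrow> 'a psdo \<Rightarrow> 'a psdo" where
  "P * Q = Abs_psdo (\<lambda>m.
     \<Sum>(i, l) \<in> {(i, l). psdo_coeff P i \<noteq> 0 \<and> psdo_coeff Q (m - i + int l) \<noteq> 0}.
       (of_int i gchoose l) * psdo_coeff P i * (fls_deriv ^^ l) (psdo_coeff Q (m - i + int l)))"

instance ..

end

lemma psdo_coeff_bounded: "\<exists>n. \<forall>i>n. psdo_coeff P i = 0"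
  using psdo_coeff[of P] by simp

lemma finite_psdo_times_support:
  "finite {(i, l). psdo_coeff P i \<noteq> 0 \<and> psdo_coeff Q (m - i + int l) \<noteq> 0}"
proof -
  obtain p where p: "\<forall>i>p. psdo_coeff P i = 0" using psdo_coeff_bounded by blast
  obtain q where q: "\<forall>i>q. psdo_coeff Q i = 0" using psdo_coeff_bounded by blast
  have "{(i, l). psdo_coeff P i \<noteq> 0 \<and> psdo_coeff Q (m - i + int l) \<noteq> 0}
          \<subseteq> {m - q..p} \<times> {..nat (p + q - m)}"
  proof clarify
    fix i l
    assume "psdo_coeff P i \<noteq> 0" "psdo_coeff Q (m - i + int l) \<noteq> 0"
    hence "i \<le> p" "m - i + int l \<le> q" using p q by (meson not_le)+
    thus "i \<in> {m - q..p} \<and> l \<in> {..nat (p + q - m)}" by auto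
  qed
  thus ?thesis by (rule finite_subset) simp
qed

lemma psdo_coeff_times:
  "psdo_coeff (P * Q) m =
     (\<Sum>(i, l) \<in> {(i, l). psdo_coeff P i \<noteq> 0 \<and> psdo_coeff Q (m - i + int l) \<noteq> 0}.
        (of_int i gchoose l) * psdo_coeff P i * (fls_deriv ^^ l) (psdo_coeff Q (m - i + int l)))"
proof -
  obtain p where p: "\<forall>i>p. psdo_coeff P i = 0" using psdo_coeff_bounded by blast
  obtain q where q: "\<forall>i>q. psdo_coeff Q i = 0" using psdo_coeff_bounded by blast
  let ?c = "\<lambda>m. \<Sum>(i, l) \<in> {(i, l). psdo_coeff P i \<noteq> 0 \<and> psdo_coeff Q (m - i + int l) \<noteq> 0}.
        (of_int i gchoose l) * psdo_coeff P i * (fls_deriv ^^ l) (psdo_coeff Q (m - i + int l))"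
  have "?c n = 0" if n: "n > p + q" for n
  proof -
    have False if "psdo_coeff P i \<noteq> 0" "psdo_coeff Q (n - i + int l) \<noteq> 0" for i l
    proof -
      from that have "i \<le> p" "n - i + int l \<le> q" using p q by (meson not_le)+
      with n show False by linarith
    qed
    thus ?thesis by (intro sum.neutral) blast
  qed
  hence "?c \<in> {c. \<exists>n. \<forall>i>n. c i = 0}" by blast
  thus ?thesis unfolding times_psdo_def by (subst Abs_psdo_inverse) (assumption, rule refl)
qed

definition psdo_inverse :: "'k::field_char_0 psdo \<Rightarrow> 'k psdo" where
  "psdo_inverse P = (THE Q. P * Q = 1 \<and> Q * P = 1)"

definition psdo_of_fls :: "'k::zero fls \<Rightarrow> 'k psdo" where
  "psdo_of_fls a = Abs_psdo (\<lambda>i. if i = 0 then a else 0)"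

abbreviation psdo_x :: "'k::field_char_0 psdo" where
  "psdo_x \<equiv> psdo_of_fls fls_X"

definition psdo_E :: "'k::zero psdo set" where
  "psdo_E = {P. \<forall>i. psdo_coeff P i \<in> range fps_to_fls}"

definition monic0 :: "'k::field_char_0 psdo set" where
  "monic0 = {S. psdo_coeff S 0 = 1 \<and> (\<forall>i>0. psdo_coeff S i = 0)}"

text \<open>The coordinate \<open>a\<^sub>i\<^sub>j\<close> of \<open>\<Sum> a\<^sub>i\<^sub>j x\<^sup>i \<partial>\<^sup>-\<^sup>j\<close>, where \<open>j \<ge> 1\<close>.\<close>

definition psdo_coord :: "int \<Rightarrow> nat \<Rightarrow> 'k::zero psdo \<Rightarrow> 'k" where
  "psdo_coord i j S = fls_nth (psdo_coeff S (- int j)) i"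

definition quasiregular :: "'k::field_char_0 psdo set" where
  "quasiregular = {S \<in> monic0. \<exists>m n :: nat.
     psdo_of_fls (fls_X ^ m) * S \<in> psdo_E \<and> psdo_inverse S * psdo_of_fls (fls_X ^ n) \<in> psdo_E}"


section \<open>The action of \<open>E\<close> on \<open>V = k((z))\<close>\<close>

text \<open>The operator \<open>\<Sum>i. v\<^sub>i \<partial>\<^sup>-\<^sup>i\<close> with constant coefficients, for \<open>v = \<Sum>i. v\<^sub>i z\<^sup>i\<close> in \<open>k((z))\<close>.\<close>

definition psdo_of_symbol :: "'k::zero fls \<Rightarrow> 'k psdo" where
  "psdo_of_symbol v = Abs_psdo (\<lambda>i. fls_const (fls_nth v (- i)))"

text \<open>
  Every class of \<open>E\<close> modulo the left ideal \<open>E x\<close> contains exactly one operator with constant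
  coefficients. Through these representatives \<open>E / E x\<close> is \<open>V\<close>, with \<open>z\<close> the class of \<open>\<partial>\<^sup>-\<^sup>1\<close>.
\<close>

definition psdo_class :: "'k::field_char_0 psdo \<Rightarrow> 'k fls" where
  "psdo_class P = (THE v. \<exists>Q\<in>psdo_E. P - psdo_of_symbol v = Q * psdo_x)"

definition psdo_act :: "'k::field_char_0 psdo \<Rightarrow> 'k fls \<Rightarrow> 'k fls" where
  "psdo_act P v = psdo_class (P * psdo_of_symbol v)"


section \<open>The zero component of the Sato Grassmannian\<close>

definition scaleV :: "'k::field \<Rightarrow> 'k fls \<Rightarrow> 'k fls" where
  "scaleV c f = fls_const c * f"

definition scaleVV :: "'k::field \<Rightarrow> 'k fls \<times> 'k fls \<Rightarrow> 'k fls \<times> 'k fls" where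
  "scaleVV c p = (scaleV c (fst p), scaleV c (snd p))"

text \<open>
  The quotient \<open>A / U\<close> of linear subspaces has dimension \<open>d\<close>: the classes of the elements of some
  \<open>d\<close>-element set \<open>B\<close> are a basis, i.e. every class has unique coordinates with respect to \<open>B\<close>.
\<close>

definition has_quotient_dim ::
    "('k::field \<Rightarrow> 'v::ab_group_add \<Rightarrow> 'v) \<Rightarrow> 'v set \<Rightarrow> 'v set \<Rightarrow> nat \<Rightarrow> bool" where
  "has_quotient_dim sc A U d \<longleftrightarrow>
     (\<exists>B\<subseteq>A. finite B \<and> card B = d \<and>
        (\<forall>v\<in>A. \<exists>!c. c \<in> B \<rightarrow>\<^sub>E UNIV \<and> v - (\<Sum>b\<in>B. sc (c b) b) \<in> U))"

definition zkz :: "'k::field fls set" where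
  "zkz = {v. \<forall>i\<le>0. fls_nth v i = 0}"

text \<open>
  The map in question, with \<open>zkz\<close> standing for \<open>z k[[z]]\<close>, is
  \<open>W \<oplus> z k[[z]] \<rightarrow> V, (w, u) \<mapsto> w + u\<close>; the two sets below are its kernel and its image.
\<close>

definition Gr0 :: "'k::field fls set set" where
  "Gr0 = {W. module.subspace scaleV W \<and>
     (\<exists>d. has_quotient_dim scaleVV {(w, u). w \<in> W \<and> u \<in> zkz \<and> w + u = 0} {0} d \<and>
          has_quotient_dim scaleV UNIV {w + u | w u. w \<in> W \<and> u \<in> zkz} d)}"

definition W0 :: "'k::field fls set" where
  "W0 = module.span scaleV {fls_X powi (- int l) | l. l \<ge> 0}"

text \<open>The value does not depend on the choice of \<open>n\<close>, because \<open>x W0 = W0\<close>.\<close>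

definition sato_gamma :: "'k::field_char_0 psdo \<Rightarrow> 'k fls set" where
  "sato_gamma S =
     (let n = (SOME n :: nat. psdo_inverse S * psdo_of_fls (fls_X ^ n) \<in> psdo_E)
      in psdo_act (psdo_inverse S * psdo_of_fls (fls_X ^ n)) ` W0)"

definition sato_gamma_inv :: "'k::field_char_0 fls set \<Rightarrow> 'k psdo" where
  "sato_gamma_inv = the_inv_into quasiregular sato_gamma"


section \<open>The projective line\<close>

definition proj_rel :: "(('k::field \<times> 'k) \<times> ('k \<times> 'k)) set" where
  "proj_rel = {((a, b), (a', b')). (a, b) \<noteq> (0, 0) \<and> (\<exists>c. c \<noteq> 0 \<and> a' = c * a \<and> b' = c * b)}"

definition P1 :: "('k::field \<times> 'k) set set" where
  "P1 = (UNIV - {(0, 0)}) // proj_rel"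

definition P1_point :: "'k::field \<times> 'k \<Rightarrow> ('k \<times> 'k) set" where
  "P1_point v = proj_rel `` {v}"

definition W_line :: "'k::field \<Rightarrow> 'k \<Rightarrow> 'k fls set" where
  "W_line \<alpha> \<beta> = module.span scaleV
     ({fls_X powi (- int l) | l. l \<ge> 1} \<union> {fls_const \<alpha> + fls_const \<beta> * fls_X})"

definition projective_R :: "'k::field fls set set" where
  "projective_R = {W_line \<alpha> \<beta> | \<alpha> \<beta>. (\<alpha>, \<beta>) \<noteq> (0, 0)}"

text \<open>\<open>W_line\<close> is invariant under rescaling, so the image below is a singleton.\<close>

definition W_at :: "('k::field \<times> 'k) set \<Rightarrow> 'k fls set" where
  "W_at p = the_elem ((\<lambda>(\<alpha>, \<beta>). W_line \<alpha> \<beta>) ` p)"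

definition coord_on_P1 :: "int \<Rightarrow> nat \<Rightarrow> ('k::field_char_0 \<times> 'k) set \<Rightarrow> 'k" where
  "coord_on_P1 i j p = psdo_coord i j (sato_gamma_inv (W_at p))"


section \<open>Topologies on the projective line and on \<open>k\<close>\<close>

definition binary_form :: "nat \<Rightarrow> (nat \<Rightarrow> 'k::field) \<Rightarrow> 'k \<times> 'k \<Rightarrow> 'k" where
  "binary_form d c v = (\<Sum>i\<le>d. c i * fst v ^ i * snd v ^ (d - i))"

definition zariski_P1 :: "('k::field \<times> 'k) set topology" where
  "zariski_P1 = topology_generated_by {{p \<in> P1. \<forall>v\<in>p. binary_form d c v \<noteq> 0} | d c. True}"

definition zariski_A1 :: "'k::field topology" where
  "zariski_A1 = topology_generated_by {{t. poly f t \<noteq> 0} | f. True}"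

definition regular_on_P1 :: "(('k::field \<times> 'k) set \<Rightarrow> 'k) \<Rightarrow> bool" where
  "regular_on_P1 f \<longleftrightarrow>
     (\<forall>p\<in>P1. \<exists>U d a b. openin zariski_P1 U \<and> p \<in> U \<and>
        (\<forall>q\<in>U. \<forall>v\<in>q. binary_form d b v \<noteq> 0 \<and> f q = binary_form d a v / binary_form d b v))"

definition nondiscrete_field_topology :: "'k::field topology \<Rightarrow> bool" where
  "nondiscrete_field_topology \<tau> \<longleftrightarrow>
     topspace \<tau> = UNIV \<and> Hausdorff_space \<tau> \<and> \<tau> \<noteq> discrete_topology UNIV \<and>
     continuous_map (prod_topology \<tau> \<tau>) \<tau> (\<lambda>(s, t). s + t) \<and>
     continuous_map (prod_topology \<tau> \<tau>) \<tau> (\<lambda>(s, t). s * t) \<and>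
     continuous_map \<tau> \<tau> uminus \<and>
     continuous_map (subtopology \<tau> (UNIV - {0})) \<tau> inverse"

definition P1_topology :: "'k::field topology \<Rightarrow> ('k \<times> 'k) set topology" where
  "P1_topology \<tau> = topology (\<lambda>U. U \<subseteq> P1 \<and>
     openin (subtopology (prod_topology \<tau> \<tau>) (UNIV - {(0, 0)}))
       {v \<in> topspace (prod_topology \<tau> \<tau>) - {(0, 0)}. P1_point v \<in> U})"

lemma openin_P1_topology:
  "openin (P1_topology \<tau>) U \<longleftrightarrow> U \<subseteq> P1 \<and>
     openin (subtopology (prod_topology \<tau> \<tau>) (UNIV - {(0, 0)}))
       {v \<in> topspace (prod_topology \<tau> \<tau>) - {(0, 0)}. P1_point v \<in> U}"
proof -
  let ?X = "subtopology (prod_topology \<tau> \<tau>) (UNIV - {(0, 0)})"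
  let ?pre = "\<lambda>U. {v \<in> topspace (prod_topology \<tau> \<tau>) - {(0, 0)}. P1_point v \<in> U}"
  have "istopology (\<lambda>U. U \<subseteq> P1 \<and> openin ?X (?pre U))"
    unfolding istopology_def
  proof (intro conjI allI impI)
    fix S T
    assume S: "S \<subseteq> P1 \<and> openin ?X (?pre S)" and T: "T \<subseteq> P1 \<and> openin ?X (?pre T)"
    have "?pre (S \<inter> T) = ?pre S \<inter> ?pre T" by auto
    thus "openin ?X (?pre (S \<inter> T))" using S T by (metis (no_types, lifting) openin_Int)
    show "S \<inter> T \<subseteq> P1" using S by blast
  next
    fix \<K>
    assume K: "\<forall>K\<in>\<K>. K \<subseteq> P1 \<and> openin ?X (?pre K)"
    have "?pre (\<Union>\<K>) = (\<Union>K\<in>\<K>. ?pre K)" by auto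
    moreover have "openin ?X (\<Union>K\<in>\<K>. ?pre K)" using K by (intro openin_Union) auto
    ultimately show "openin ?X (?pre (\<Union>\<K>))" by (rule ssubst)
    show "\<Union>\<K> \<subseteq> P1" using K by blast
  qed
  thus ?thesis unfolding P1_topology_def by (simp add: topology_inverse')
qed

end

theory Submission
  imports Defs
begin

text \<open>
  With \<open>u = \<alpha> + \<beta> x\<close>, the operator \<open>S = 1 - (\<beta> / u) \<partial>\<^sup>-\<^sup>1\<close> satisfies \<open>S (u + \<beta> \<partial>\<^sup>-\<^sup>1) = u\<close>,
  so that \<open>S\<^sup>-\<^sup>1 u = u + \<beta> \<partial>\<^sup>-\<^sup>1\<close>. This operator maps \<open>z\<^sup>i\<close> to \<open>\<alpha> z\<^sup>i + \<beta> (i + 1) z\<^sup>i\<^sup>+\<^sup>1\<close>, and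
  therefore \<open>W\<^sub>0\<close> onto \<open>W(\<alpha>, \<beta>)\<close>. Up to a power of \<open>x\<close>, \<open>u\<close> is a unit that preserves \<open>W\<^sub>0\<close>,
  hence \<open>\<gamma> S = W(\<alpha>, \<beta>)\<close>, and the coordinates are the Laurent coefficients of \<open>- \<beta> / u\<close>.

  \<open>\<gamma>\<close> is injective: if \<open>\<gamma> S = \<gamma> T\<close>, then \<open>D = x\<^sup>a T S\<^sup>-\<^sup>1 x\<^sup>n - x\<^sup>a\<^sup>+\<^sup>n\<close>, for suitable \<open>a\<close> and \<open>n\<close>,
  lies in \<open>E\<close>, has negative degree and preserves \<open>W\<^sub>0\<close>. Such a \<open>D\<close> is \<open>Q x\<close> with \<open>Q\<close> of the same
  kind, so it is divisible by all powers of \<open>x\<close> and vanishes.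

  In the chart \<open>t \<mapsto> (t : 1)\<close> the coordinate \<open>a\<^sub>-\<^sub>1\<^sub>,\<^sub>1\<close> is supported at \<open>t = 0\<close>, and
  \<open>t a\<^sub>0\<^sub>,\<^sub>1\<close> is \<open>-1\<close> except at \<open>t = 0\<close>; continuity of either would make \<open>{0}\<close> open.
  The coordinate \<open>a\<^sub>0\<^sub>,\<^sub>1\<close> takes each value at most twice, so it is continuous for the Zariski
  topology, but it is not regular.
\<close>

section \<open>Iterated derivatives\<close>

lemma fls_deriv_pow_0 [simp]: "(fls_deriv ^^ l) (0 :: 'a::field_char_0 fls) = 0"
  by (induction l) auto

lemma fls_deriv_pow_add:
  "(fls_deriv ^^ l) (a + b :: 'a::field_char_0 fls) = (fls_deriv ^^ l) a + (fls_deriv ^^ l) b"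
  by (induction l) auto

lemma fls_deriv_pow_const_mult:
  "(fls_deriv ^^ l) (fls_const c * b :: 'a::field_char_0 fls) = fls_const c * (fls_deriv ^^ l) b"
  by (induction l) auto

lemma fls_deriv_pow_const [simp]:
  "(fls_deriv ^^ l) (fls_const c :: 'a::field_char_0 fls) = (if l = 0 then fls_const c else 0)"
  by (induction l) auto

text \<open>The iterated Leibniz rule, by induction and Pascal's rule.\<close>

lemma fls_deriv_pow_mult:
  fixes a b :: "'a::field_char_0 fls"
  shows "(fls_deriv ^^ n) (a * b) =
    (\<Sum>k\<le>n. of_nat (n choose k) * ((fls_deriv ^^ k) a * (fls_deriv ^^ (n - k)) b))"
proof (induction n)
  case (Suc n)
  let ?f = "\<lambda>k. (fls_deriv ^^ k) a * (fls_deriv ^^ (Suc n - k)) b"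
  have "(fls_deriv ^^ Suc n) (a * b) =
      (\<Sum>k\<le>n. of_nat (n choose k) * (?f (Suc k) + ?f k))"
    unfolding funpow.simps o_apply Suc fls_deriv_sum
    by (intro sum.cong refl) (simp add: fls_deriv_mult_const_left fls_of_nat Suc_diff_le algebra_simps)
  also have "\<dots> = (\<Sum>k\<le>n. of_nat (n choose k) * ?f (Suc k)) + (\<Sum>k\<le>n. of_nat (n choose k) * ?f k)"
    by (simp add: sum.distrib ring_distribs)
  \<comment> \<open>The added term has binomial coefficient 0; splitting off \<open>k = 0\<close>
    then aligns both sums on \<open>?f (Suc k)\<close>.\<close>
  also have "(\<Sum>k\<le>n. of_nat (n choose k) * ?f k) = (\<Sum>k\<le>Suc n. of_nat (n choose k) * ?f k)"
    by (simp add: binomial_eq_0)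
  also have "\<dots> = ?f 0 + (\<Sum>k\<le>n. of_nat (n choose Suc k) * ?f (Suc k))"
    by (subst sum.atMost_Suc_shift) simp
  also have "(\<Sum>k\<le>n. of_nat (n choose k) * ?f (Suc k)) +
      (?f 0 + (\<Sum>k\<le>n. of_nat (n choose Suc k) * ?f (Suc k))) =
      (\<Sum>k\<le>Suc n. of_nat (Suc n choose k) * ?f k)"
    by (subst sum.atMost_Suc_shift) (simp add: sum.distrib ring_distribs)
  finally show ?case .
qed auto

lemma fls_const_prod: "fls_const (prod f A) = (\<Prod>x\<in>A. fls_const (f x :: 'a::field_char_0))"
  by (induction A rule: infinite_finite_induct) (auto simp del: fls_const_mult_const simp flip: fls_const_mult_const)

text \<open>The product formula takes its binomial coefficients in \<open>k((x))\<close>. As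
  constants they commute with derivations and are integral. After multiplication by
  \<open>fact l\<close> both sides are the same falling factorial.\<close>

lemma of_int_gchoose_fls:
  "(of_int i gchoose l :: 'a::field_char_0 fls) = fls_const (of_int i gchoose l)"
proof -
  have "fact l * (of_int i gchoose l :: 'a fls) = (\<Prod>j<l. of_int i - of_nat j)"
    by (simp add: gbinomial_mult_fact atLeast0LessThan)
  also have "\<dots> = fls_const (\<Prod>j<l. of_int i - of_nat j)"
    by (simp add: fls_const_prod fls_of_nat fls_of_int flip: fls_minus_const)
  also have "\<dots> = fls_const (fact l * (of_int i gchoose l))"
    by (simp add: gbinomial_mult_fact atLeast0LessThan)
  also have "\<dots> = of_nat (fact l) * fls_const (of_int i gchoose l)"
    unfolding fls_of_nat by simp
  finally show ?thesis by simp
qed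

section \<open>The ring of pseudo-differential operators\<close>

lemma psdo_eqI: "(\<And>i. psdo_coeff P i = psdo_coeff Q i) \<Longrightarrow> P = Q"
  by (metis ext psdo_coeff_inject)

lemma psdo_coeff_Abs:
  assumes "\<And>i. i > n \<Longrightarrow> c i = 0"
  shows "psdo_coeff (Abs_psdo c) = c"
  using assms by (intro Abs_psdo_inverse) blast

lemma psdo_coeff_zero [simp]: "psdo_coeff 0 i = 0"
  unfolding zero_psdo_def by (subst psdo_coeff_Abs) auto

lemma psdo_coeff_one: "psdo_coeff 1 i = (if i = 0 then 1 else 0)"
  unfolding one_psdo_def by (subst psdo_coeff_Abs[of 0]) auto

lemma psdo_coeff_of_fls: "psdo_coeff (psdo_of_fls a) i = (if i = 0 then a else 0)"
  unfolding psdo_of_fls_def by (subst psdo_coeff_Abs[of 0]) auto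

lemma psdo_coeff_of_symbol: "psdo_coeff (psdo_of_symbol v) i = fls_const (fls_nth v (- i))"
  unfolding psdo_of_symbol_def
  by (subst psdo_coeff_Abs[of "- fls_subdegree v"]) auto

text \<open>An upper bound for the order rather than the order itself: leading terms may cancel in
  sums, and 0 satisfies every bound.\<close>

definition psdo_le :: "int \<Rightarrow> 'k::zero psdo \<Rightarrow> bool" where
  "psdo_le n P \<longleftrightarrow> (\<forall>i>n. psdo_coeff P i = 0)"

lemma psdo_leD: "psdo_le n P \<Longrightarrow> n < i \<Longrightarrow> psdo_coeff P i = 0"
  by (simp add: psdo_le_def)

lemma psdo_le_exists: "\<exists>n. psdo_le n P"
  using psdo_coeff_bounded[of P] by (auto simp: psdo_le_def)

lemma psdo_le_mono: "psdo_le n P \<Longrightarrow> n \<le> m \<Longrightarrow> psdo_le m P"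
  by (auto simp: psdo_le_def)

lemma psdo_le_common: "\<exists>n. psdo_le n P \<and> psdo_le n Q"
  by (meson psdo_le_exists psdo_le_mono linorder_linear)

lemma psdo_coeff_plus [simp]: "psdo_coeff (P + Q) i = psdo_coeff P i + psdo_coeff Q i"
proof -
  obtain n where "psdo_le n P" "psdo_le n Q" using psdo_le_common by blast
  thus ?thesis unfolding plus_psdo_def by (subst psdo_coeff_Abs[of n]) (auto simp: psdo_le_def)
qed

lemma psdo_coeff_minus [simp]: "psdo_coeff (P - Q) i = psdo_coeff P i - psdo_coeff Q i"
proof -
  obtain n where "psdo_le n P" "psdo_le n Q" using psdo_le_common by blast
  thus ?thesis unfolding minus_psdo_def by (subst psdo_coeff_Abs[of n]) (auto simp: psdo_le_def)
qed

section \<open>Coefficients of products and distributivity\<close>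

lemma psdo_coeff_times_superset:
  assumes "finite A"
    and "\<And>i l. (i, l) \<notin> A \<Longrightarrow> psdo_coeff P i = 0 \<or> psdo_coeff Q (m - i + int l) = 0"
  shows "psdo_coeff (P * Q) m = (\<Sum>(i, l)\<in>A.
    (of_int i gchoose l) * psdo_coeff P i * (fls_deriv ^^ l) (psdo_coeff Q (m - i + int l)))"
  unfolding psdo_coeff_times by (rule sum.mono_neutral_left) (use assms in auto)

text \<open>A nonzero term needs \<open>i \<le> p\<close> and \<open>m - i + int l \<le> q\<close>,
  hence \<open>m - q \<le> i\<close> and \<open>l \<le> p + q - m\<close>. Unlike the support, this
  rectangle depends on the order bounds only, so that sums for different factors can be compared
  term by term.\<close>

lemma psdo_coeff_times_box:
  assumes "psdo_le p P" "psdo_le q Q" "lo \<le> m - q" "p \<le> p'" "p + q - m \<le> int L"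
  shows "psdo_coeff (P * Q) m = (\<Sum>(i, l)\<in>{lo..p'} \<times> {..L}.
    (of_int i gchoose l) * psdo_coeff P i * (fls_deriv ^^ l) (psdo_coeff Q (m - i + int l)))"
proof (rule psdo_coeff_times_superset)
  fix i l
  assume "(i, l) \<notin> {lo..p'} \<times> {..L}"
  hence "i < lo \<or> p' < i \<or> L < l" by auto
  hence "p < i \<or> q < m - i + int l" using assms(3-5) by linarith
  thus "psdo_coeff P i = 0 \<or> psdo_coeff Q (m - i + int l) = 0"
    using assms(1,2) by (auto dest: psdo_leD)
qed simp

lemma psdo_le_times:
  assumes "psdo_le p P" "psdo_le q Q"
  shows "psdo_le (p + q) (P * Q)"
  unfolding psdo_le_def
proof (intro allI impI)
  fix m assume "p + q < m"
  hence "p < i \<or> q < m - i + int l" for i l by linarith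
  hence "psdo_coeff P i = 0 \<or> psdo_coeff Q (m - i + int l) = 0" for i l
    using assms psdo_leD by blast
  hence "psdo_coeff (P * Q) m = sum (\<lambda>_. 0) {}"
    by (subst psdo_coeff_times_superset[of "{}"]) auto
  thus "psdo_coeff (P * Q) m = 0" by simp
qed

lemma psdo_le_plus: "psdo_le p P \<Longrightarrow> psdo_le p Q \<Longrightarrow> psdo_le p (P + Q)"
  by (auto simp: psdo_le_def)

lemma psdo_le_minus: "psdo_le p P \<Longrightarrow> psdo_le p Q \<Longrightarrow> psdo_le p (P - Q)"
  by (auto simp: psdo_le_def)

lemma psdo_distrib_right: "(P + P') * Q = P * Q + P' * (Q :: 'a::field_char_0 psdo)"
proof (rule psdo_eqI)
  fix m
  obtain p where p: "psdo_le p P" "psdo_le p P'" using psdo_le_common by blast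
  obtain q where q: "psdo_le q Q" using psdo_le_exists by blast
  note box = psdo_coeff_times_box[where lo = "m - q" and p = p and p' = p and q = q
      and m = m and L = "nat (p + q - m)"]
  show "psdo_coeff ((P + P') * Q) m = psdo_coeff (P * Q + P' * Q) m"
    using p q by (simp add: box psdo_le_plus case_prod_unfold ring_distribs flip: sum.distrib)
qed

lemma psdo_distrib_left: "P * (Q + Q') = P * Q + P * (Q' :: 'a::field_char_0 psdo)"
proof (rule psdo_eqI)
  fix m
  obtain q where q: "psdo_le q Q" "psdo_le q Q'" using psdo_le_common by blast
  obtain p where p: "psdo_le p P" using psdo_le_exists by blast
  note box = psdo_coeff_times_box[where lo = "m - q" and p = p and p' = p and q = q
      and m = m and L = "nat (p + q - m)"]
  show "psdo_coeff (P * (Q + Q')) m = psdo_coeff (P * Q + P * Q') m"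
    using p q by (simp add: box psdo_le_plus case_prod_unfold ring_distribs fls_deriv_pow_add
        flip: sum.distrib)
qed

section \<open>Monomials and their associativity\<close>

definition psdo_mono :: "'k::zero fls \<Rightarrow> int \<Rightarrow> 'k psdo" where
  "psdo_mono a i = Abs_psdo (\<lambda>j. if j = i then a else 0)"

lemma psdo_coeff_mono: "psdo_coeff (psdo_mono a i) j = (if j = i then a else 0)"
  unfolding psdo_mono_def by (subst psdo_coeff_Abs[of i]) auto

lemma psdo_le_psdo_mono [simp]: "psdo_le i (psdo_mono a i)"
  by (auto simp: psdo_le_def psdo_coeff_mono)

lemma psdo_coeff_mono_times:
  assumes "psdo_le q Q" "q + i - m \<le> int L"
  shows "psdo_coeff (psdo_mono a i * Q) m =
    (\<Sum>l\<le>L. (of_int i gchoose l) * a * (fls_deriv ^^ l) (psdo_coeff Q (m - i + int l)))"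
proof -
  have "psdo_coeff (psdo_mono a i * Q) m = (\<Sum>(i', l)\<in>{i} \<times> {..L}. (of_int i' gchoose l) *
      psdo_coeff (psdo_mono a i) i' * (fls_deriv ^^ l) (psdo_coeff Q (m - i' + int l)))"
  proof (rule psdo_coeff_times_superset)
    fix i' l
    assume "(i', l) \<notin> {i} \<times> {..L}"
    hence "i' \<noteq> i \<or> q < m - i' + int l" using assms(2) by auto
    thus "psdo_coeff (psdo_mono a i) i' = 0 \<or> psdo_coeff Q (m - i' + int l) = 0"
      using assms(1) by (auto simp: psdo_coeff_mono dest: psdo_leD)
  qed simp
  thus ?thesis by (simp add: psdo_coeff_mono flip: sum.cartesian_product)
qed

lemma psdo_coeff_times_mono:
  assumes "psdo_le p P" "p + k - m \<le> int L"
  shows "psdo_coeff (P * psdo_mono c k) m =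
    (\<Sum>l\<le>L. (of_int (m - k + int l) gchoose l) * psdo_coeff P (m - k + int l) * (fls_deriv ^^ l) c)"
proof -
  have "psdo_coeff (P * psdo_mono c k) m = (\<Sum>(i, l)\<in>(\<lambda>l. (m - k + int l, l)) ` {..L}.
      (of_int i gchoose l) * psdo_coeff P i * (fls_deriv ^^ l) (psdo_coeff (psdo_mono c k) (m - i + int l)))"
  proof (rule psdo_coeff_times_superset)
    fix i l
    assume "(i, l) \<notin> (\<lambda>l. (m - k + int l, l)) ` {..L}"
    hence "i \<noteq> m - k + int l \<or> L < l" by auto
    hence "m - i + int l \<noteq> k \<or> p < i" using assms(2) by linarith
    thus "psdo_coeff P i = 0 \<or> psdo_coeff (psdo_mono c k) (m - i + int l) = 0"
      using assms(1) by (auto simp: psdo_coeff_mono dest: psdo_leD)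
  qed simp
  also have "\<dots> = (\<Sum>l\<le>L. (of_int (m - k + int l) gchoose l) * psdo_coeff P (m - k + int l) * (fls_deriv ^^ l) c)"
    by (subst sum.reindex) (auto simp: inj_on_def psdo_coeff_mono)
  finally show ?thesis .
qed

lemma psdo_coeff_mono_times_mono:
  "psdo_coeff (psdo_mono a i * psdo_mono b j) (i + j - int n) =
     (of_int i gchoose n) * a * (fls_deriv ^^ n) b"
proof -
  have "psdo_coeff (psdo_mono a i * psdo_mono b j) (i + j - int n) = (\<Sum>l\<le>n.
      (of_int i gchoose l) * a * (fls_deriv ^^ l) (psdo_coeff (psdo_mono b j) (i + j - int n - i + int l)))"
    by (rule psdo_coeff_mono_times[of j]) auto
  \<comment> \<open>Only \<open>l = n\<close> hits the single degree \<open>j\<close> of the second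
    factor.\<close>
  also have "\<dots> = (\<Sum>l\<in>{n}. (of_int i gchoose l) * a * (fls_deriv ^^ l) b)"
    by (rule sum.mono_neutral_cong_right) (auto simp: psdo_coeff_mono)
  finally show ?thesis by simp
qed

text \<open>Trinomial revision pulls out \<open>x gchoose s\<close>; what remains is a Vandermonde
  convolution for \<open>x - s\<close> and \<open>y\<close>. This is the identity behind
  associativity.\<close>

lemma gchoose_Vandermonde_trinomial:
  fixes x y :: "'a::field_char_0"
  assumes "s \<le> n"
  shows "(\<Sum>r=s..n. (x gchoose r) * of_nat (r choose s) * (y gchoose (n - r))) =
    (x gchoose s) * ((x + y - of_nat s) gchoose (n - s))"
proof -
  have "(\<Sum>r=s..n. (x gchoose r) * of_nat (r choose s) * (y gchoose (n - r))) =
      (\<Sum>r=s..n. (x gchoose s) * (((x - of_nat s) gchoose (r - s)) * (y gchoose (n - r))))"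
    by (intro sum.cong refl)
       (use gbinomial_trinomial_revision[of s _ x] in \<open>simp add: binomial_gbinomial mult.assoc\<close>)
  also have "\<dots> = (\<Sum>t=0..n - s. (x gchoose s) * (((x - of_nat s) gchoose t) * (y gchoose (n - s - t))))"
    using assms by (intro sum.reindex_bij_witness[of _ "\<lambda>t. t + s" "\<lambda>r. r - s"]) auto
  also have "\<dots> = (x gchoose s) * ((x + y - of_nat s) gchoose (n - s))"
    unfolding sum_distrib_left[symmetric] gbinomial_Vandermonde by (simp add: algebra_simps)
  finally show ?thesis .
qed

text \<open>In degree \<open>i + j + k - n\<close> both products are combinations of the terms
  \<open>a * ?D s b * ?D (n - s) c\<close>. On the right they arise by the Leibniz rule for
  \<open>?D r (b * ?D (n - r) c)\<close>, and the coefficients agree by the Vandermonde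
  identity.\<close>

lemma psdo_mono_times_assoc:
  fixes a b c :: "'a::field_char_0 fls"
  shows "psdo_mono a i * psdo_mono b j * psdo_mono c k = psdo_mono a i * (psdo_mono b j * psdo_mono c k)"
proof (rule psdo_eqI)
  fix m
  let ?D = "\<lambda>l. fls_deriv ^^ l"
  let ?L = "psdo_mono a i * psdo_mono b j * psdo_mono c k"
  let ?R = "psdo_mono a i * (psdo_mono b j * psdo_mono c k)"
  have le: "psdo_le (i + j) (psdo_mono a i * psdo_mono b j)"
    "psdo_le (j + k) (psdo_mono b j * psdo_mono c k)"
    by (simp_all add: psdo_le_times)
  show "psdo_coeff ?L m = psdo_coeff ?R m"
  proof (cases "m \<le> i + j + k")
    case True
    define n where "n = nat (i + j + k - m)"
    have m: "m = i + j + k - int n" using True by (simp add: n_def)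
    have "psdo_coeff ?R m = (\<Sum>r\<le>n. (of_int i gchoose r) * a *
        ?D r (psdo_coeff (psdo_mono b j * psdo_mono c k) (m - i + int r)))"
      by (rule psdo_coeff_mono_times[OF le(2)]) (simp add: m)
    also have "\<dots> = (\<Sum>r\<le>n. (of_int i gchoose r) * a * ?D r ((of_int j gchoose (n - r)) * (b * ?D (n - r) c)))"
    proof (intro sum.cong refl)
      fix r assume "r \<in> {..n}"
      hence "m - i + int r = j + k - int (n - r)" by (simp add: m of_nat_diff)
      thus "(of_int i gchoose r) * a * ?D r (psdo_coeff (psdo_mono b j * psdo_mono c k) (m - i + int r)) =
         (of_int i gchoose r) * a * ?D r ((of_int j gchoose (n - r)) * (b * ?D (n - r) c))"
        by (simp only: psdo_coeff_mono_times_mono mult.assoc)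
    qed
    also have "\<dots> = (\<Sum>r\<le>n. \<Sum>s\<le>r. a * ?D s b * ?D (n - s) c *
        ((of_int i gchoose r) * of_nat (r choose s) * (of_int j gchoose (n - r))))"
    proof (intro sum.cong refl)
      fix r assume "r \<in> {..n}"
      hence "?D r (b * ?D (n - r) c) = (\<Sum>s\<le>r. of_nat (r choose s) * (?D s b * ?D (n - s) c))"
        unfolding fls_deriv_pow_mult
        by (intro sum.cong refl) (simp flip: funpow_add[unfolded o_def, THEN fun_cong])
      thus "(of_int i gchoose r) * a * ?D r ((of_int j gchoose (n - r)) * (b * ?D (n - r) c)) =
          (\<Sum>s\<le>r. a * ?D s b * ?D (n - s) c *
            ((of_int i gchoose r) * of_nat (r choose s) * (of_int j gchoose (n - r))))"
        unfolding of_int_gchoose_fls[of j] fls_deriv_pow_const_mult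
        by (simp add: sum_distrib_left mult_ac)
    qed
    \<comment> \<open>Exchange of the two sums over the triangle
      \<open>s \<le> r \<le> n\<close>.\<close>
    also have "\<dots> = (\<Sum>s\<le>n. \<Sum>r=s..n. a * ?D s b * ?D (n - s) c *
        ((of_int i gchoose r) * of_nat (r choose s) * (of_int j gchoose (n - r))))"
      by (subst sum.Sigma, simp, simp, subst sum.Sigma, simp, simp,
          rule sum.reindex_bij_witness[of _ "\<lambda>(s, r). (r, s)" "\<lambda>(r, s). (s, r)"]) auto
    also have "\<dots> = (\<Sum>s\<le>n. a * ?D s b * ?D (n - s) c *
        ((of_int i gchoose s) * ((of_int i + of_int j - of_nat s) gchoose (n - s))))"
      by (intro sum.cong refl) (simp add: gchoose_Vandermonde_trinomial flip: sum_distrib_left)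
    \<comment> \<open>With \<open>l = n - s\<close>, the index counts the derivatives that fall on
      \<open>c\<close>, as in the left product.\<close>
    also have "\<dots> = (\<Sum>l\<le>n. a * ?D (n - l) b * ?D l c *
        ((of_int i gchoose (n - l)) * ((of_int i + of_int j - of_nat (n - l)) gchoose l)))"
      by (rule sum.reindex_bij_witness[of _ "\<lambda>l. n - l" "\<lambda>l. n - l"]) auto
    also have "\<dots> = (\<Sum>l\<le>n. (of_int (m - k + int l) gchoose l) *
        psdo_coeff (psdo_mono a i * psdo_mono b j) (m - k + int l) * ?D l c)"
    proof (intro sum.cong refl)
      fix l assume "l \<in> {..n}"
      hence eq: "m - k + int l = i + j - int (n - l)" by (simp add: m of_nat_diff)
      show "a * ?D (n - l) b * ?D l c *
        ((of_int i gchoose (n - l)) * ((of_int i + of_int j - of_nat (n - l)) gchoose l)) =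
        (of_int (m - k + int l) gchoose l) *
        psdo_coeff (psdo_mono a i * psdo_mono b j) (m - k + int l) * ?D l c"
        unfolding eq psdo_coeff_mono_times_mono by (simp add: mult_ac del: of_nat_diff)
    qed
    also have "\<dots> = psdo_coeff ?L m"
      by (rule psdo_coeff_times_mono[OF le(1), symmetric]) (simp add: m)
    finally show ?thesis by simp
  next
    case False
    thus ?thesis
      using psdo_le_times[OF le(1) psdo_le_psdo_mono[of k c]]
        psdo_le_times[OF psdo_le_psdo_mono[of i a] le(2)]
      by (simp add: psdo_leD)
  qed
qed

section \<open>The additive group and associativity in general\<close>

instantiation psdo :: (field_char_0) uminus
begin

definition uminus_psdo :: "'a psdo \<Rightarrow> 'a psdo" where
  "uminus_psdo P = 0 - P"

instance ..

end

lemma psdo_coeff_uminus [simp]: "psdo_coeff (- P) i = - psdo_coeff P i"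
  unfolding uminus_psdo_def by simp

instance psdo :: (field_char_0) ab_group_add
  by intro_classes (rule psdo_eqI; simp)+

lemma psdo_coeff_sum [simp]:
  "psdo_coeff (\<Sum>x\<in>A. f x) i = (\<Sum>x\<in>A. psdo_coeff (f x :: 'a::field_char_0 psdo) i)"
  by (induction A rule: infinite_finite_induct) auto

text \<open>The bounds on \<open>psdo_le\<close> express continuity for the degree filtration.\<close>

lemma psdo_additive_eqI:
  fixes F G :: "'a::field_char_0 psdo \<Rightarrow> 'a psdo"
  assumes F: "\<And>P P'. F (P + P') = F P + F P'" "\<And>n P. psdo_le n P \<Longrightarrow> psdo_le (n + c) (F P)"
    and G: "\<And>P P'. G (P + P') = G P + G P'" "\<And>n P. psdo_le n P \<Longrightarrow> psdo_le (n + c) (G P)"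
    and mono: "\<And>a i. F (psdo_mono a i) = G (psdo_mono a i)"
  shows "F P = G P"
proof (rule psdo_eqI)
  fix m
  obtain p where p: "psdo_le p P" using psdo_le_exists by blast
  \<comment> \<open>Both maps shift order bounds by \<open>c\<close>, so only the degrees of
    \<open>P\<close> from \<open>N\<close> on can reach degree \<open>m\<close>. They form the
    finite sum of monomials \<open>T\<close>.\<close>
  define N where "N = m - c"
  define T where "T = (\<Sum>i\<in>{N..p}. psdo_mono (psdo_coeff P i) i)"
  have zero: "F 0 = 0" "G 0 = 0" using F(1)[of 0 0] G(1)[of 0 0] by simp_all
  have eq: "F (sum f A) = G (sum f A)"
    if "\<And>x. x \<in> A \<Longrightarrow> F (f x) = G (f x)" for f :: "int \<Rightarrow> 'a psdo" and A
    using that by (induction A rule: infinite_finite_induct) (simp_all add: zero F(1) G(1))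
  have T: "psdo_le (N - 1) (P - T)"
    unfolding psdo_le_def
  proof (intro allI impI)
    fix i assume i: "N - 1 < i"
    have "psdo_coeff T i = (\<Sum>j\<in>{N..p}. if i = j then psdo_coeff P j else 0)"
      unfolding T_def psdo_coeff_sum psdo_coeff_mono ..
    also have "\<dots> = psdo_coeff P i" using i p by (auto simp: psdo_le_def)
    finally show "psdo_coeff (P - T) i = 0" by simp
  qed
  have "psdo_le (m - 1) (F (P - T))" "psdo_le (m - 1) (G (P - T))"
    using F(2)[OF T] G(2)[OF T] by (simp_all add: N_def)
  hence "psdo_coeff (F (P - T)) m = psdo_coeff (G (P - T)) m"
    by (simp add: psdo_le_def)
  moreover have "F P = F (P - T) + F T" "G P = G (P - T) + G T"
    using F(1)[of "P - T" T] G(1)[of "P - T" T] by simp_all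
  moreover have "F T = G T" unfolding T_def by (rule eq) (rule mono)
  ultimately show "psdo_coeff (F P) m = psdo_coeff (G P) m" by simp
qed

text \<open>Associativity is extended from monomials to all operators in one factor at a time: first
  the left one, then the middle one, then the right one.\<close>

lemma psdo_times_assoc:
  fixes P Q R :: "'a::field_char_0 psdo"
  shows "P * Q * R = P * (Q * R)"
proof -
  have 1: "P * psdo_mono b j * psdo_mono c k = P * (psdo_mono b j * psdo_mono c k)" for b c j k
  proof (rule psdo_additive_eqI[where c = "j + k" and F = "\<lambda>P. P * psdo_mono b j * psdo_mono c k"
        and G = "\<lambda>P. P * (psdo_mono b j * psdo_mono c k)"])
    fix n and P :: "'a psdo" assume n: "psdo_le n P"
    show "psdo_le (n + (j + k)) (P * psdo_mono b j * psdo_mono c k)"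
      unfolding add.assoc[symmetric] by (intro psdo_le_times n psdo_le_psdo_mono)
    show "psdo_le (n + (j + k)) (P * (psdo_mono b j * psdo_mono c k))"
      by (intro psdo_le_times n psdo_le_psdo_mono)
  qed (simp_all add: psdo_distrib_right psdo_mono_times_assoc)
  obtain p where p: "psdo_le p P" using psdo_le_exists by blast
  have 2: "P * Q * psdo_mono c k = P * (Q * psdo_mono c k)" for c k
  proof (rule psdo_additive_eqI[where c = "p + k" and F = "\<lambda>Q. P * Q * psdo_mono c k"
        and G = "\<lambda>Q. P * (Q * psdo_mono c k)"])
    fix n and Q :: "'a psdo" assume n: "psdo_le n Q"
    have "n + (p + k) = p + n + k" "n + (p + k) = p + (n + k)" by simp_all
    thus "psdo_le (n + (p + k)) (P * Q * psdo_mono c k)"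
      "psdo_le (n + (p + k)) (P * (Q * psdo_mono c k))"
      using p n by (metis psdo_le_times psdo_le_psdo_mono)+
  qed (simp_all add: psdo_distrib_right psdo_distrib_left 1)
  obtain q where q: "psdo_le q Q" using psdo_le_exists by blast
  show ?thesis
  proof (rule psdo_additive_eqI[where c = "p + q" and F = "\<lambda>R. P * Q * R"
        and G = "\<lambda>R. P * (Q * R)"])
    fix n and R :: "'a psdo" assume n: "psdo_le n R"
    have "n + (p + q) = p + q + n" "n + (p + q) = p + (q + n)" by simp_all
    thus "psdo_le (n + (p + q)) (P * Q * R)" "psdo_le (n + (p + q)) (P * (Q * R))"
      using p q n by (metis psdo_le_times)+
  qed (simp_all add: psdo_distrib_left 2)
qed

section \<open>Multiplication operators and the ring axioms\<close>

lemma psdo_of_fls_eq_mono: "psdo_of_fls a = psdo_mono a 0"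
  by (rule psdo_eqI) (simp add: psdo_coeff_of_fls psdo_coeff_mono)

lemma psdo_coeff_of_fls_times [simp]: "psdo_coeff (psdo_of_fls a * P) m = a * psdo_coeff P m"
proof -
  obtain p where p: "psdo_le p P" using psdo_le_exists by blast
  have "psdo_coeff (psdo_of_fls a * P) m = (\<Sum>l\<le>nat (p - m).
      (of_int 0 gchoose l) * a * (fls_deriv ^^ l) (psdo_coeff P (m - 0 + int l)))"
    unfolding psdo_of_fls_eq_mono by (rule psdo_coeff_mono_times[OF p]) simp
  also have "\<dots> = (\<Sum>l\<in>{0}. (of_int 0 gchoose l) * a * (fls_deriv ^^ l) (psdo_coeff P (m - 0 + int l)))"
    by (rule sum.mono_neutral_right) (auto simp: gbinomial_0_left)
  finally show ?thesis by simp
qed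

lemma psdo_of_fls_1: "psdo_of_fls 1 = 1"
  by (rule psdo_eqI) (simp add: psdo_coeff_of_fls psdo_coeff_one)

lemma psdo_coeff_times_of_fls:
  assumes "psdo_le p P" "p - m \<le> int L"
  shows "psdo_coeff (P * psdo_of_fls c) m =
    (\<Sum>l\<le>L. (of_int (m + int l) gchoose l) * psdo_coeff P (m + int l) * (fls_deriv ^^ l) c)"
  using psdo_coeff_times_mono[where k = 0, OF assms(1), of m L c] assms(2) by (simp add: psdo_of_fls_eq_mono)

lemma psdo_coeff_times_1: "psdo_coeff (P * 1) m = psdo_coeff P m"
proof -
  obtain p where p: "psdo_le p P" using psdo_le_exists by blast
  have "psdo_coeff (P * psdo_of_fls 1) m = (\<Sum>l\<le>nat (p - m).
      (of_int (m + int l) gchoose l) * psdo_coeff P (m + int l) * (fls_deriv ^^ l) 1)"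
    by (rule psdo_coeff_times_of_fls[OF p]) simp
  also have "\<dots> = (\<Sum>l\<in>{0}. (of_int (m + int l) gchoose l) * psdo_coeff P (m + int l) * (fls_deriv ^^ l) 1)"
    by (rule sum.mono_neutral_right) (auto simp flip: fls_const_1)
  finally show ?thesis by (simp add: psdo_of_fls_1)
qed

instance psdo :: (field_char_0) ring_1
proof
  fix P Q R :: "'a psdo"
  show "P * Q * R = P * (Q * R)" by (rule psdo_times_assoc)
  show "(P + Q) * R = P * R + Q * R" by (rule psdo_distrib_right)
  show "P * (Q + R) = P * Q + P * R" by (rule psdo_distrib_left)
  show "1 * P = P" by (rule psdo_eqI) (simp flip: psdo_of_fls_1)
  show "P * 1 = P" by (rule psdo_eqI) (rule psdo_coeff_times_1)
  have "psdo_coeff (0 :: 'a psdo) 0 \<noteq> psdo_coeff 1 0" by (simp add: psdo_coeff_one)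
  thus "(0 :: 'a psdo) \<noteq> 1" by metis
qed

lemma psdo_of_fls_mult: "psdo_of_fls (a * b) = psdo_of_fls a * psdo_of_fls b"
  by (rule psdo_eqI) (simp add: psdo_coeff_of_fls)

lemma psdo_of_fls_power: "psdo_of_fls (a ^ n) = psdo_of_fls a ^ n"
  by (induction n) (simp_all add: psdo_of_fls_1 psdo_of_fls_mult)

text \<open>This is \<open>\<partial>^i x = x \<partial>^i + i \<partial>^(i-1)\<close>, exact
  because the second derivative of \<open>x\<close> vanishes.\<close>

lemma psdo_coeff_times_x:
  "psdo_coeff (P * psdo_x) m = psdo_coeff P m * fls_X + of_int (m + 1) * psdo_coeff P (m + 1)"
proof -
  obtain p where p: "psdo_le p P" using psdo_le_exists by blast
  let ?f = "\<lambda>l. (of_int (m + int l) gchoose l) * psdo_coeff P (m + int l) * (fls_deriv ^^ l) fls_X"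
  have 0: "(fls_deriv ^^ l) fls_X = (0 :: 'a fls)" if "l \<notin> {0, 1}" for l
  proof -
    have "l = (l - 2) + Suc (Suc 0)" using that by auto
    moreover have "(fls_deriv ^^ (k + Suc (Suc 0))) fls_X = (0 :: 'a fls)" for k
      unfolding funpow_add o_apply by simp
    ultimately show ?thesis by metis
  qed
  have "psdo_coeff (P * psdo_x) m = (\<Sum>l\<le>nat (p - m) + 1. ?f l)"
    by (rule psdo_coeff_times_of_fls[OF p]) simp
  also have "\<dots> = (\<Sum>l\<in>{0, 1}. ?f l)"
    by (rule sum.mono_neutral_right) (auto simp: 0)
  finally show ?thesis by simp
qed

section \<open>Inverses of monic operators of degree zero\<close>

lemma psdo_le_one: "psdo_le 0 1"
  by (simp add: psdo_le_def psdo_coeff_one)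

lemma psdo_le_power: "psdo_le (-1) N \<Longrightarrow> psdo_le (- int k) (N ^ k)"
proof (induction k)
  case (Suc k)
  thus ?case using psdo_le_times[of "-1" N "- int k" "N ^ k"] by simp
qed (simp add: psdo_le_one)

lemma psdo_eq_0I: "(\<And>n. psdo_le (- int n) P) \<Longrightarrow> P = 0"
proof (rule psdo_eqI)
  fix i assume "\<And>n. psdo_le (- int n) P"
  from this[of "nat (1 - i)"] show "psdo_coeff P i = psdo_coeff 0 i" by (simp add: psdo_le_def)
qed

lemma geometric_sum_times:
  fixes N :: "'a::ring_1"
  shows "(1 - N) * (\<Sum>k<K. N ^ k) = 1 - N ^ K" "(\<Sum>k<K. N ^ k) * (1 - N) = 1 - N ^ K"
proof -
  show *: "(1 - N) * (\<Sum>k<K. N ^ k) = 1 - N ^ K" for K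
  proof (induction K)
    case (Suc K)
    have "(1 - N) * N ^ K = N ^ K - N ^ Suc K" by (simp add: algebra_simps)
    thus ?case by (simp only: sum.lessThan_Suc distrib_left Suc) simp
  qed simp
  have "N * (\<Sum>k<K. N ^ k) = (\<Sum>k<K. N ^ k) * N"
    by (simp add: sum_distrib_left sum_distrib_right power_commutes)
  thus "(\<Sum>k<K. N ^ k) * (1 - N) = 1 - N ^ K"
    using *[of K] by (simp add: algebra_simps)
qed

text \<open>The inverse is the Neumann series of \<open>S = 1 - N\<close>. It converges in each
  degree, because \<open>N\<close> has negative order and so \<open>N ^ k\<close> has order at most
  \<open>-k\<close>.\<close>

lemma monic0_invertible:
  assumes "S \<in> monic0"
  obtains Q where "psdo_le 0 Q" "S * Q = 1" "Q * S = 1"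
proof -
  define N where "N = 1 - S"
  have N: "psdo_le (-1) N"
    using assms by (auto simp: psdo_le_def N_def monic0_def psdo_coeff_one order.order_iff_strict)
  \<comment> \<open>Powers with \<open>k > - m\<close> do not reach degree \<open>m\<close>. For
    positive \<open>m\<close> only \<open>N ^ 0 = 1\<close> is summed, whose coefficient there is
    0.\<close>
  define c where "c = (\<lambda>m. \<Sum>k\<le>nat (- m). psdo_coeff (N ^ k) m)"
  define Q where "Q = Abs_psdo c"
  have Nk: "psdo_coeff (N ^ k) m = 0" if "- int k < m" for k m
    using psdo_le_power[OF N] that by (auto simp: psdo_le_def)
  have Q: "psdo_coeff Q = c"
    unfolding Q_def by (rule psdo_coeff_Abs[of 0]) (simp add: c_def psdo_coeff_one)
  \<comment> \<open>Replacing \<open>Q\<close> by a partial sum costs order at most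
    \<open>- K\<close>, and the geometric sum leaves only \<open>N ^ K\<close>. As \<open>K\<close>
    is arbitrary, both defects from 1 vanish.\<close>
  have le: "psdo_le (- int K) (Q - (\<Sum>k<K. N ^ k))" for K
    unfolding psdo_le_def
  proof (intro allI impI)
    fix m assume m: "- int K < m"
    have "(\<Sum>k<K. psdo_coeff (N ^ k) m) = c m"
      unfolding c_def by (rule sum.mono_neutral_cong) (use m in \<open>auto intro!: Nk\<close>)
    thus "psdo_coeff (Q - (\<Sum>k<K. N ^ k)) m = 0" by (simp add: Q)
  qed
  have S: "S = 1 - N" "psdo_le 0 S"
    using assms by (auto simp: N_def monic0_def psdo_le_def)
  have "S * Q - 1 = 0"
  proof (rule psdo_eq_0I)
    fix K
    have "S * Q - 1 = S * (Q - (\<Sum>k<K. N ^ k)) - N ^ K"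
      unfolding right_diff_distrib by (simp add: S(1) geometric_sum_times)
    moreover have "psdo_le (- int K) (S * (Q - (\<Sum>k<K. N ^ k)))"
      using psdo_le_times[OF S(2) le[of K]] by simp
    ultimately show "psdo_le (- int K) (S * Q - 1)"
      by (simp only: psdo_le_minus psdo_le_power[OF N])
  qed
  moreover have "Q * S - 1 = 0"
  proof (rule psdo_eq_0I)
    fix K
    have "Q * S - 1 = (Q - (\<Sum>k<K. N ^ k)) * S - N ^ K"
      unfolding left_diff_distrib by (simp add: S(1) geometric_sum_times)
    moreover have "psdo_le (- int K) ((Q - (\<Sum>k<K. N ^ k)) * S)"
      using psdo_le_times[OF le[of K] S(2)] by simp
    ultimately show "psdo_le (- int K) (Q * S - 1)"
      by (simp only: psdo_le_minus psdo_le_power[OF N])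
  qed
  moreover have "psdo_le 0 Q"
    unfolding psdo_le_def Q by (simp add: c_def psdo_coeff_one)
  ultimately show ?thesis by (intro that[of Q]) (simp_all only: right_minus_eq)
qed

lemma psdo_inverse_unique:
  assumes "P * Q = 1" "Q * P = 1"
  shows "psdo_inverse P = Q"
  unfolding psdo_inverse_def
proof (rule the_equality)
  fix R assume "P * R = 1 \<and> R * P = 1"
  hence "Q * (P * R) = Q" by simp
  thus "R = Q" by (simp add: assms(2) flip: mult.assoc)
qed (use assms in simp)

lemma psdo_inverse_monic0:
  assumes "S \<in> monic0"
  shows "S * psdo_inverse S = 1" "psdo_inverse S * S = 1" "psdo_le 0 (psdo_inverse S)"
proof -
  obtain Q where "psdo_le 0 Q" "S * Q = 1" "Q * S = 1" using monic0_invertible[OF assms] by blast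
  thus "S * psdo_inverse S = 1" "psdo_inverse S * S = 1" "psdo_le 0 (psdo_inverse S)"
    by (simp_all add: psdo_inverse_unique)
qed

section \<open>Operators with integral coefficients\<close>

lemma range_fps_to_fls_iff: "a \<in> range fps_to_fls \<longleftrightarrow> (\<forall>i<0. fls_nth a i = 0)"
proof
  assume "\<forall>i<0. fls_nth a i = 0"
  hence "a = fps_to_fls (fls_regpart a)" by (intro fls_eqI) simp
  thus "a \<in> range fps_to_fls" by blast
qed auto

lemma range_fps_to_fls_mult:
  "a \<in> range fps_to_fls \<Longrightarrow> b \<in> range fps_to_fls \<Longrightarrow> a * b \<in> range (fps_to_fls :: 'a::semiring_1 fps \<Rightarrow> _)"
  by (auto simp flip: fls_times_fps_to_fls)

lemma range_fps_to_fls_add: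
  "a \<in> range fps_to_fls \<Longrightarrow> b \<in> range fps_to_fls \<Longrightarrow> a + b \<in> range (fps_to_fls :: 'a::monoid_add fps \<Rightarrow> _)"
  by (auto simp: range_fps_to_fls_iff)

lemma range_fps_to_fls_sum:
  "(\<And>x. x \<in> A \<Longrightarrow> f x \<in> range fps_to_fls) \<Longrightarrow>
     sum f A \<in> range (fps_to_fls :: 'a::comm_monoid_add fps \<Rightarrow> _)"
proof (induction A rule: infinite_finite_induct)
  case (insert x A)
  thus ?case using range_fps_to_fls_add[of "f x" "sum f A"] by simp
qed (simp_all add: range_fps_to_fls_iff)

lemma range_fps_to_fls_const [simp]: "fls_const c \<in> range fps_to_fls"
  by (simp add: range_fps_to_fls_iff)

lemma range_fps_to_fls_deriv_pow:
  "a \<in> range fps_to_fls \<Longrightarrow> (fls_deriv ^^ l) (a :: 'a::field_char_0 fls) \<in> range fps_to_fls"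
  by (induction l) (auto simp: fls_deriv_fps_to_fls)

text \<open>The binomial coefficients are constants and differentiation preserves
  \<open>k[[x]]\<close>.\<close>

lemma psdo_E_times:
  assumes "P \<in> psdo_E" "Q \<in> psdo_E"
  shows "P * Q \<in> (psdo_E :: 'a::field_char_0 psdo set)"
  using assms unfolding psdo_E_def psdo_coeff_times mem_Collect_eq
  by (intro allI range_fps_to_fls_sum)
     (clarify, intro range_fps_to_fls_mult range_fps_to_fls_deriv_pow,
       simp_all add: of_int_gchoose_fls)

lemma psdo_E_add: "P \<in> psdo_E \<Longrightarrow> Q \<in> psdo_E \<Longrightarrow> P + Q \<in> (psdo_E :: 'a::field_char_0 psdo set)"
  unfolding psdo_E_def by (simp add: range_fps_to_fls_iff)

lemma psdo_E_diff: "P \<in> psdo_E \<Longrightarrow> Q \<in> psdo_E \<Longrightarrow> P - Q \<in> (psdo_E :: 'a::field_char_0 psdo set)"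
  unfolding psdo_E_def by (simp add: range_fps_to_fls_iff)

lemma psdo_E_of_fls: "a \<in> range fps_to_fls \<Longrightarrow> psdo_of_fls a \<in> psdo_E"
  unfolding psdo_E_def by (auto simp: psdo_coeff_of_fls simp flip: fps_zero_to_fls)

lemma psdo_E_of_symbol: "psdo_of_symbol v \<in> psdo_E"
  unfolding psdo_E_def by (simp add: psdo_coeff_of_symbol range_fps_to_fls_iff)

lemma fls_X_power_in_range: "(fls_X ^ n :: 'a::field fls) \<in> range fps_to_fls"
  by (simp add: range_fps_to_fls_iff)

lemma psdo_E_x_power: "(psdo_x ^ n :: 'a::field_char_0 psdo) \<in> psdo_E"
  unfolding psdo_of_fls_power[symmetric] by (intro psdo_E_of_fls fls_X_power_in_range)

lemma psdo_E_x: "(psdo_x :: 'a::field_char_0 psdo) \<in> psdo_E"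
  using psdo_E_x_power[of 1] by simp

section \<open>Classes modulo \<open>E x\<close>\<close>

lemma psdo_of_symbol_add: "psdo_of_symbol (v + w) = psdo_of_symbol v + psdo_of_symbol (w :: 'a::field_char_0 fls)"
  by (rule psdo_eqI) (simp add: psdo_coeff_of_symbol fls_plus_const)

lemma psdo_of_symbol_diff: "psdo_of_symbol (v - w) = psdo_of_symbol v - psdo_of_symbol (w :: 'a::field_char_0 fls)"
  by (rule psdo_eqI) (simp add: psdo_coeff_of_symbol fls_minus_const)

text \<open>Division by \<open>x\<close> with a constant remainder amounts to solving
  \<open>P\<^sub>m = v\<^sub>-\<^sub>m + q\<^sub>m x + (m + 1) q\<^sub>m\<^sub>+\<^sub>1\<close> downwards from the top degree \<open>m = p\<close>;
  below, \<open>j = p - m\<close>.\<close>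

fun fps_quotients :: "(int \<Rightarrow> 'a::field_char_0 fps) \<Rightarrow> int \<Rightarrow> nat \<Rightarrow> 'a fps" where
  "fps_quotients r p 0 = fps_shift 1 (r p)"
| "fps_quotients r p (Suc j) =
     fps_shift 1 (r (p - int (Suc j)) - of_int (p - int j) * fps_quotients r p j)"

lemma psdo_E_division:
  fixes P :: "'a::field_char_0 psdo"
  assumes "P \<in> psdo_E" and p: "psdo_le p P"
  obtains v Q where "Q \<in> psdo_E" "psdo_le p Q" "P - psdo_of_symbol v = Q * psdo_x"
    "\<And>i. i < - p \<Longrightarrow> fls_nth v i = 0"
proof -
  define r where "r = (\<lambda>m. fls_regpart (psdo_coeff P m))"
  have r: "psdo_coeff P m = fps_to_fls (r m)" for m
    using assms(1) unfolding psdo_E_def r_def by (auto dest!: spec[of _ m])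
  have r0: "r m = 0" if "p < m" for m
    using psdo_leD[OF p that] by (simp add: r_def)
  define q where "q = (\<lambda>m. if m \<le> p then fps_quotients r p (nat (p - m)) else 0)"
  \<comment> \<open>What is left of \<open>r m\<close> after removing the contribution of the next
    higher quotient. Its constant term is the remainder, and division of the rest by
    \<open>x\<close> gives \<open>q m\<close>.\<close>
  define g where "g = (\<lambda>m. r m - of_int (m + 1) * q (m + 1))"
  have q0: "q m = 0" if "p < m" for m using that by (simp add: q_def)
  have g0: "g m = 0" if "p < m" for m using that by (simp add: g_def r0 q0)
  have q: "q m = fps_shift 1 (g m)" for m
  proof (cases "m < p")
    case True
    define j where "j = nat (p - m - 1)"
    have j: "m = p - int (Suc j)" using True by (simp add: j_def)
    have "nat (p - m) = Suc j" "nat (p - (m + 1)) = j" by (simp_all add: j)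
    thus ?thesis using True by (simp add: q_def g_def j)
  next
    case False
    thus ?thesis by (cases "m = p") (simp_all add: g_def q_def r0)
  qed
  have g: "g m = fps_const (fps_nth (g m) 0) + q m * fps_X" for m
    by (rule fps_ext) (simp add: q)
  define v where "v = Abs_fls (\<lambda>i. fps_nth (g (- i)) 0)"
  have v: "fls_nth v i = fps_nth (g (- i)) 0" for i
    unfolding v_def by (rule nth_Abs_fls_ex_lower_bound) (auto intro!: exI[of _ "- p"] simp: g0)
  define Q where "Q = Abs_psdo (\<lambda>m. fps_to_fls (q m))"
  have Q: "psdo_coeff Q m = fps_to_fls (q m)" for m
    unfolding Q_def by (subst psdo_coeff_Abs[of p]) (simp_all add: q0)
  have "P - psdo_of_symbol v = Q * psdo_x"
  proof (rule psdo_eqI)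
    fix m
    have "r m = fps_const (fps_nth (g m) 0) + q m * fps_X + of_int (m + 1) * q (m + 1)"
      unfolding g[of m, symmetric] by (simp add: g_def)
    hence "fps_to_fls (r m) = fls_const (fps_nth (g m) 0) + fps_to_fls (q m) * fls_X +
        of_int (m + 1) * fps_to_fls (q (m + 1))"
      by (simp add: fls_times_fps_to_fls)
    thus "psdo_coeff (P - psdo_of_symbol v) m = psdo_coeff (Q * psdo_x) m"
      by (simp add: psdo_coeff_times_x psdo_coeff_of_symbol r v Q)
  qed
  moreover have "Q \<in> psdo_E" "psdo_le p Q"
    by (simp_all add: psdo_E_def psdo_le_def Q q0)
  moreover have "fls_nth v i = 0" if "i < - p" for i
    using that by (simp add: v g0)
  ultimately show ?thesis using that[of Q v] by blast
qed

text \<open>Uniqueness of division by \<open>x\<close>, from the top degree downwards: once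
  \<open>Q\<close> vanishes in degree \<open>m + 1\<close>, its coefficient in degree
  \<open>m\<close> times \<open>x\<close> is a constant, and integrality leaves only 0.\<close>

lemma psdo_of_symbol_eq_times_x:
  fixes v :: "'a::field_char_0 fls"
  assumes "psdo_of_symbol v = Q * psdo_x" "Q \<in> psdo_E"
  shows "v = 0" "Q = 0"
proof -
  obtain p where p: "psdo_le p Q" using psdo_le_exists by blast
  \<comment> \<open>The induction starts one degree above the order bound, where \<open>Q\<close>
    vanishes.\<close>
  have "psdo_coeff Q (p + 1 - int j) = 0" for j
  proof (induction j)
    case (Suc j)
    define m where "m = p + 1 - int (Suc j)"
    have "m + 1 = p + 1 - int j" by (simp add: m_def)
    hence "psdo_coeff Q (m + 1) = 0" using Suc by (simp only:)
    hence *: "fls_const (fls_nth v (- m)) = psdo_coeff Q m * fls_X"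
      using arg_cong[OF assms(1), of "\<lambda>P. psdo_coeff P m"]
      by (simp add: psdo_coeff_of_symbol psdo_coeff_times_x)
    have eq: "fls_nth (psdo_coeff Q m) i = (if i = -1 then fls_nth v (- m) else 0)" for i
      using arg_cong[OF *, of "\<lambda>a. fls_nth a (i + 1)"]
      by (cases "i = -1") (auto simp: fls_X_times_conv_shift split: if_splits)
    \<comment> \<open>The only possible term is a multiple of \<open>x^-1\<close>, which integrality
      excludes.\<close>
    have "psdo_coeff Q m \<in> range fps_to_fls" using assms(2) by (simp add: psdo_E_def)
    hence "fls_nth (psdo_coeff Q m) (-1) = 0" by (simp add: range_fps_to_fls_iff)
    hence "psdo_coeff Q m = 0" using eq by (intro fls_eqI) auto
    thus ?case by (simp add: m_def)
  qed (use p in \<open>simp add: psdo_le_def\<close>)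
  hence *: "psdo_coeff Q (p + 1 - int (nat (p + 1 - m))) = 0" for m by blast
  have "psdo_coeff Q m = 0" for m
  proof (cases "m \<le> p")
    case True
    hence "p + 1 - int (nat (p + 1 - m)) = m" by simp
    with * show ?thesis by metis
  qed (use psdo_leD[OF p] in simp)
  thus "Q = 0" by (intro psdo_eqI) simp
  hence "psdo_coeff (psdo_of_symbol v) (- i) = 0" for i using assms(1) by simp
  thus "v = 0" by (intro fls_eqI) (simp add: psdo_coeff_of_symbol)
qed

lemma psdo_class_eqI:
  assumes "P - psdo_of_symbol v = Q * psdo_x" "Q \<in> psdo_E"
  shows "psdo_class P = v"
  unfolding psdo_class_def
proof (rule the_equality)
  fix w assume "\<exists>Q\<in>psdo_E. P - psdo_of_symbol w = Q * psdo_x"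
  then obtain R where R: "R \<in> psdo_E" "P - psdo_of_symbol w = R * psdo_x" by blast
  have "psdo_of_symbol (v - w) = (P - psdo_of_symbol w) - (P - psdo_of_symbol v)"
    by (simp add: psdo_of_symbol_diff)
  hence "psdo_of_symbol (v - w) = (R - Q) * psdo_x"
    by (simp only: R(2) assms(1) left_diff_distrib)
  hence "v - w = 0" by (rule psdo_of_symbol_eq_times_x(1)) (intro psdo_E_diff R(1) assms(2))
  thus "w = v" by simp
qed (use assms in blast)

lemma psdo_class_decomp:
  assumes "P \<in> psdo_E" "psdo_le p P"
  obtains Q where "Q \<in> psdo_E" "psdo_le p Q" "P - psdo_of_symbol (psdo_class P) = Q * psdo_x"
    "\<And>i. i < - p \<Longrightarrow> fls_nth (psdo_class P) i = 0"
proof -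
  obtain v Q where *: "Q \<in> psdo_E" "psdo_le p Q" "P - psdo_of_symbol v = Q * psdo_x"
    "\<And>i. i < - p \<Longrightarrow> fls_nth v i = 0"
    using psdo_E_division[OF assms] by blast
  have "psdo_class P = v" using psdo_class_eqI[OF *(3,1)] .
  thus ?thesis using * that[of Q] by blast
qed

lemma psdo_class_add:
  assumes "P \<in> psdo_E" "Q \<in> psdo_E"
  shows "psdo_class (P + Q) = psdo_class P + psdo_class Q"
proof -
  obtain p q where pq: "psdo_le p P" "psdo_le q Q" using psdo_le_exists by blast
  obtain P' where P': "P' \<in> psdo_E" "P - psdo_of_symbol (psdo_class P) = P' * psdo_x"
    using psdo_class_decomp[OF assms(1) pq(1)] by blast
  obtain Q' where Q': "Q' \<in> psdo_E" "Q - psdo_of_symbol (psdo_class Q) = Q' * psdo_x"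
    using psdo_class_decomp[OF assms(2) pq(2)] by blast
  show ?thesis
  proof (rule psdo_class_eqI)
    have "P + Q - psdo_of_symbol (psdo_class P + psdo_class Q) =
        (P - psdo_of_symbol (psdo_class P)) + (Q - psdo_of_symbol (psdo_class Q))"
      by (simp add: psdo_of_symbol_add)
    thus "P + Q - psdo_of_symbol (psdo_class P + psdo_class Q) = (P' + Q') * psdo_x"
      by (simp only: P'(2) Q'(2) distrib_right)
  qed (rule psdo_E_add[OF P'(1) Q'(1)])
qed

section \<open>The action of \<open>E\<close> on \<open>V\<close>\<close>

lemma psdo_act_eqI:
  assumes "P * psdo_of_symbol v = psdo_of_symbol w + Q * psdo_x" "Q \<in> psdo_E"
  shows "psdo_act P v = w"
  unfolding psdo_act_def by (rule psdo_class_eqI[of _ _ Q]) (simp_all add: assms)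

lemma psdo_act_decomp:
  assumes "P \<in> psdo_E"
  obtains Q where "Q \<in> psdo_E" "P * psdo_of_symbol v = psdo_of_symbol (psdo_act P v) + Q * psdo_x"
proof -
  have "P * psdo_of_symbol v \<in> psdo_E" using assms psdo_E_of_symbol psdo_E_times by blast
  moreover obtain p where "psdo_le p (P * psdo_of_symbol v)" using psdo_le_exists by blast
  ultimately obtain Q where "Q \<in> psdo_E"
      "P * psdo_of_symbol v - psdo_of_symbol (psdo_act P v) = Q * psdo_x"
    unfolding psdo_act_def using psdo_class_decomp by blast
  thus ?thesis using that[of Q] by (simp add: diff_eq_eq add.commute)
qed

text \<open>\<open>E x\<close> is a left ideal: the error \<open>R * psdo_x\<close> of the inner
  class stays in it after multiplication by \<open>P\<close> from the left.\<close>

lemma psdo_act_times: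
  assumes "P \<in> psdo_E" "Q \<in> psdo_E"
  shows "psdo_act (P * Q) v = psdo_act P (psdo_act Q v)"
proof -
  obtain R where R: "R \<in> psdo_E" "Q * psdo_of_symbol v = psdo_of_symbol (psdo_act Q v) + R * psdo_x"
    using psdo_act_decomp[OF assms(2)] by blast
  obtain R' where R': "R' \<in> psdo_E" "P * psdo_of_symbol (psdo_act Q v) =
      psdo_of_symbol (psdo_act P (psdo_act Q v)) + R' * psdo_x"
    using psdo_act_decomp[OF assms(1)] by blast
  show ?thesis
  proof (rule psdo_act_eqI)
    show "P * Q * psdo_of_symbol v = psdo_of_symbol (psdo_act P (psdo_act Q v)) + (R' + P * R) * psdo_x"
      by (simp add: mult.assoc R(2) R'(2) distrib_left distrib_right)
  qed (use assms R R' psdo_E_add psdo_E_times in blast)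
qed

lemma psdo_act_add:
  assumes "P \<in> psdo_E" "Q \<in> psdo_E"
  shows "psdo_act (P + Q) v = psdo_act P v + psdo_act Q v"
  unfolding psdo_act_def distrib_right
  by (intro psdo_class_add psdo_E_times assms psdo_E_of_symbol)

lemma psdo_act_const: "psdo_act (psdo_of_fls (fls_const c)) v = fls_const c * v"
proof (rule psdo_act_eqI[where Q = 0])
  show "psdo_of_fls (fls_const c) * psdo_of_symbol v = psdo_of_symbol (fls_const c * v) + 0 * psdo_x"
    by (rule psdo_eqI) (simp add: psdo_coeff_of_symbol)
qed (simp add: psdo_E_def range_fps_to_fls_iff)

text \<open>On \<open>V\<close>, \<open>x\<close> acts as \<open>z^2 d/dz\<close>: in
  \<open>x \<partial>^-j = \<partial>^-j x + j \<partial>^(-j-1)\<close> the first summand lies in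
  \<open>E x\<close>.\<close>

lemma fls_nth_psdo_act_x: "fls_nth (psdo_act psdo_x v) i = of_int (i - 1) * fls_nth v (i - 1)"
proof -
  define w where "w = fls_X ^ 2 * fls_deriv v"
  have w: "fls_nth w i = of_int (i - 1) * fls_nth v (i - 1)" for i
    by (simp add: w_def fls_X_power_times_conv_shift algebra_simps)
  have "psdo_act psdo_x v = w"
  proof (rule psdo_act_eqI)
    show "psdo_x * psdo_of_symbol v = psdo_of_symbol w + psdo_of_symbol v * psdo_x"
      by (rule psdo_eqI)
         (simp add: psdo_coeff_of_symbol psdo_coeff_times_x w fls_of_int fls_plus_const algebra_simps
           del: of_int_add of_int_diff flip: fls_const_uminus, simp add: algebra_simps)
  qed (rule psdo_E_of_symbol)
  thus ?thesis by (simp add: w)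
qed

section \<open>Linear subspaces of \<open>k((z))\<close>\<close>

interpretation scaleV: vector_space "scaleV :: 'k::field \<Rightarrow> 'k fls \<Rightarrow> 'k fls"
  by unfold_locales (simp_all add: scaleV_def algebra_simps fls_plus_const[symmetric])

lemma fls_nth_scaleV [simp]: "fls_nth (scaleV c v) i = c * fls_nth v i"
  by (simp add: scaleV_def)

lemma fls_exists_nth:
  assumes "\<And>i. i < N \<Longrightarrow> f i = 0"
  obtains v where "\<And>i. fls_nth v i = f i"
proof
  show "fls_nth (Abs_fls f) i = f i" for i
    by (rule nth_Abs_fls_ex_lower_bound) (use assms in blast)
qed

lemma fls_nth_sum: "fls_nth (\<Sum>x\<in>A. f x) i = (\<Sum>x\<in>A. fls_nth (f x) i)"
  by (induction A rule: infinite_finite_induct) auto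

text \<open>A Laurent series is bounded below, so with exponents bounded above as well it is a
  finite combination.\<close>

lemma fls_in_span_powers:
  fixes v :: "'k::field fls"
  assumes "\<And>i. i > - int m \<Longrightarrow> fls_nth v i = 0"
  shows "v \<in> scaleV.span {fls_X powi (- int l) | l. l \<ge> m}"
proof -
  obtain N where N: "\<And>i. i < - int N \<Longrightarrow> fls_nth v i = 0"
  proof
    show "fls_nth v i = 0" if "i < - int (nat (- fls_subdegree v))" for i
      by (rule fls_eq0_below_subdegree) (use that in linarith)
  qed
  have "v = (\<Sum>l\<in>{m..N}. scaleV (fls_nth v (- int l)) (fls_X powi (- int l)))"
  proof (rule fls_eqI)
    fix i
    have "fls_nth (\<Sum>l\<in>{m..N}. scaleV (fls_nth v (- int l)) (fls_X powi (- int l))) i =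
        (\<Sum>l\<in>{m..N}. if l = nat (- i) \<and> i \<le> 0 then fls_nth v (- int l) else 0)"
      unfolding fls_nth_sum by (intro sum.cong) auto
    also have "\<dots> = (if i \<le> 0 \<and> nat (- i) \<in> {m..N} then fls_nth v i else 0)"
      by (cases "i \<le> 0") (auto simp: sum.delta)
    also have "\<dots> = fls_nth v i"
      using assms[of i] N[of i] by auto
    finally show "fls_nth v i = fls_nth (\<Sum>l\<in>{m..N}. scaleV (fls_nth v (- int l)) (fls_X powi (- int l))) i" ..
  qed
  also have "\<dots> \<in> scaleV.span {fls_X powi (- int l) | l. l \<ge> m}"
    by (intro scaleV.span_sum scaleV.span_scale scaleV.span_base) auto
  finally show ?thesis .
qed

lemma W0_eq: "W0 = {v :: 'k::field fls. \<forall>i>0. fls_nth v i = 0}"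
proof
  show "W0 \<subseteq> {v :: 'k fls. \<forall>i>0. fls_nth v i = 0}"
    unfolding W0_def by (rule scaleV.span_minimal) (auto intro!: scaleV.subspaceI)
  show "{v :: 'k fls. \<forall>i>0. fls_nth v i = 0} \<subseteq> W0"
    unfolding W0_def using fls_in_span_powers[of 0] by auto
qed

lemma W_line_eq:
  "W_line a b = {v :: 'k::field fls. (\<forall>i\<ge>2. fls_nth v i = 0) \<and>
     (\<exists>t. fls_nth v 0 = t * a \<and> fls_nth v 1 = t * b)}" (is "_ = ?W")
proof
  show "W_line a b \<subseteq> ?W"
    unfolding W_line_def
  proof (rule scaleV.span_minimal)
    show "scaleV.subspace ?W"
    proof (rule scaleV.subspaceI)
      fix v w assume "v \<in> ?W" "w \<in> ?W"
      then obtain s t where "fls_nth v 0 = s * a" "fls_nth v 1 = s * b" "fls_nth w 0 = t * a"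
        "fls_nth w 1 = t * b" by blast
      hence "fls_nth (v + w) 0 = (s + t) * a" "fls_nth (v + w) 1 = (s + t) * b"
        by (simp_all add: algebra_simps)
      moreover have "\<forall>i\<ge>2. fls_nth (v + w) i = 0" using \<open>v \<in> ?W\<close> \<open>w \<in> ?W\<close> by simp
      ultimately show "v + w \<in> ?W" by blast
    next
      fix c v assume "v \<in> ?W"
      then obtain t where "fls_nth v 0 = t * a" "fls_nth v 1 = t * b" by blast
      hence "fls_nth (scaleV c v) 0 = (c * t) * a" "fls_nth (scaleV c v) 1 = (c * t) * b"
        by simp_all
      moreover have "\<forall>i\<ge>2. fls_nth (scaleV c v) i = 0" using \<open>v \<in> ?W\<close> by simp
      ultimately show "scaleV c v \<in> ?W" by blast
    qed (auto intro: exI[of _ 0])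
    show "{fls_X powi (- int l) | l. l \<ge> 1} \<union> {fls_const a + fls_const b * fls_X} \<subseteq> ?W"
      by (auto intro: exI[of _ 0] exI[of _ 1])
  qed
  show "?W \<subseteq> W_line a b"
  proof
    fix v assume "v \<in> ?W"
    then obtain t where t: "fls_nth v 0 = t * a" "fls_nth v 1 = t * b" "\<forall>i\<ge>2. fls_nth v i = 0"
      by blast
    \<comment> \<open>Subtracting \<open>t\<close> times the generator removes degrees 0 and 1
      simultaneously.\<close>
    define g where "g = fls_const a + fls_const b * fls_X"
    have "fls_nth (v - scaleV t g) i = 0" if "i > - int 1" for i
    proof -
      have "i = 0 \<or> i = 1 \<or> i \<ge> 2" using that by linarith
      thus ?thesis using t by (auto simp: g_def)
    qed
    hence "v - scaleV t g \<in> scaleV.span {fls_X powi (- int l) | l. l \<ge> 1}"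
      by (rule fls_in_span_powers)
    hence "v - scaleV t g \<in> W_line a b"
      unfolding W_line_def by (rule rev_subsetD) (intro scaleV.span_mono, blast)
    moreover have "scaleV t g \<in> W_line a b"
      unfolding W_line_def g_def by (intro scaleV.span_scale scaleV.span_base) blast
    ultimately have "v - scaleV t g + scaleV t g \<in> W_line a b"
      unfolding W_line_def by (rule scaleV.span_add)
    thus "v \<in> W_line a b" by simp
  qed
qed

section \<open>Injectivity of \<open>\<gamma>\<close>\<close>

text \<open>Since \<open>x\<close> sends \<open>z^j\<close> to \<open>j z^(j+1)\<close>, it kills 1,
  so nothing leaves \<open>W0\<close>; every \<open>z^(j+1)\<close> with \<open>j < 0\<close> is
  reached, as \<open>j\<close> is invertible in characteristic 0.\<close>

lemma psdo_act_x_W0: "psdo_act psdo_x ` W0 = (W0 :: 'k::field_char_0 fls set)"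
proof
  show "psdo_act psdo_x ` W0 \<subseteq> (W0 :: 'k fls set)"
  proof (rule image_subsetI)
    fix v :: "'k fls" assume v: "v \<in> W0"
    have "of_int (i - 1) * fls_nth v (i - 1) = 0" if "0 < i" for i
      using v that by (cases "i = 1") (simp_all add: W0_eq)
    thus "psdo_act psdo_x v \<in> W0" by (simp add: W0_eq fls_nth_psdo_act_x)
  qed
  show "(W0 :: 'k fls set) \<subseteq> psdo_act psdo_x ` W0"
  proof
    fix w :: "'k fls" assume w: "w \<in> W0"
    \<comment> \<open>The coefficient of \<open>v\<close> in degree 0 is arbitrary, since
      \<open>x\<close> annihilates it; it is set to 0.\<close>
    obtain v where v: "\<And>i. fls_nth v i = (if i < 0 then fls_nth w (i + 1) / of_int i else 0)"
      by (rule fls_exists_nth[of "min 0 (fls_subdegree w - 1)"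
            "\<lambda>i. if i < 0 then fls_nth w (i + 1) / of_int i else 0"]) auto
    have "psdo_act psdo_x v = w"
    proof (rule fls_eqI)
      fix i
      have "fls_nth (psdo_act psdo_x v) i = of_int (i - 1) * fls_nth v (i - 1)"
        by (rule fls_nth_psdo_act_x)
      also have "\<dots> = fls_nth w i"
      proof (cases "i < 1")
        case True
        hence "(of_int (i - 1) :: 'k) \<noteq> 0" by (simp only: of_int_eq_0_iff)
        thus ?thesis using True by (simp add: v del: of_int_diff)
      qed (use w in \<open>simp add: W0_eq v\<close>)
      finally show "fls_nth (psdo_act psdo_x v) i = fls_nth w i" .
    qed
    moreover have "v \<in> W0" by (simp add: W0_eq v)
    ultimately show "w \<in> psdo_act psdo_x ` W0" by blast
  qed
qed

lemma psdo_act_1: "psdo_act 1 v = v"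
  by (rule psdo_act_eqI[of _ _ _ 0]) (simp_all add: psdo_E_def range_fps_to_fls_iff)

lemma psdo_act_x_power_W0: "psdo_act (psdo_x ^ n) ` W0 = (W0 :: 'k::field_char_0 fls set)"
proof (induction n)
  case (Suc n)
  have "psdo_act (psdo_x ^ Suc n) ` W0 = psdo_act psdo_x ` psdo_act (psdo_x ^ n) ` (W0 :: 'k fls set)"
    unfolding image_image power_Suc by (simp add: psdo_act_times psdo_E_x psdo_E_x_power)
  thus ?case by (simp add: Suc psdo_act_x_W0)
qed (simp add: psdo_act_1)

text \<open>Because \<open>x\<close> maps \<open>W0\<close> onto itself. This makes
  \<open>\<gamma>\<close> independent of the exponent and lets a right factor \<open>x\<close> be
  stripped from a stabilizer of \<open>W0\<close>.\<close>

lemma psdo_act_times_x_power_W0: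
  assumes "P \<in> psdo_E"
  shows "psdo_act (P * psdo_x ^ n) ` W0 = psdo_act P ` W0"
proof -
  have "psdo_act (P * psdo_x ^ n) ` W0 = psdo_act P ` psdo_act (psdo_x ^ n) ` W0"
    unfolding image_image by (simp add: psdo_act_times assms psdo_E_x_power)
  thus ?thesis by (simp add: psdo_act_x_power_W0)
qed

text \<open>Since \<open>D\<close> maps \<open>1 \<in> W\<^sub>0\<close> to an element of \<open>W\<^sub>0 \<inter> z k[[z]] = 0\<close>, it lies in \<open>E x\<close>.\<close>

lemma psdo_stabilizer_divisible:
  fixes D :: "'k::field_char_0 psdo"
  assumes "D \<in> psdo_E" "psdo_le (-1) D" "psdo_act D ` W0 \<subseteq> W0"
  obtains Q where "Q \<in> psdo_E" "psdo_le (-1) Q" "psdo_act Q ` W0 \<subseteq> W0" "D = Q * psdo_x"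
proof -
  obtain Q where Q: "Q \<in> psdo_E" "psdo_le (-1) Q" "D - psdo_of_symbol (psdo_class D) = Q * psdo_x"
    and 0: "\<And>i. i < - (-1) \<Longrightarrow> fls_nth (psdo_class D) i = 0"
    using psdo_class_decomp[OF assms(1,2)] by blast
  have "psdo_of_symbol (1 :: 'k fls) = 1"
    by (rule psdo_eqI) (simp add: psdo_coeff_of_symbol psdo_coeff_one)
  hence "psdo_class D = psdo_act D 1" by (simp add: psdo_act_def)
  also have "\<dots> \<in> W0" by (rule set_mp[OF assms(3) imageI]) (simp add: W0_eq)
  finally have "fls_nth (psdo_class D) i = 0" for i using 0[of i] by (cases "i > 0") (auto simp: W0_eq)
  hence "psdo_class D = 0" by (intro fls_eqI) simp
  moreover have "psdo_of_symbol 0 = (0 :: 'k psdo)" by (rule psdo_eqI) (simp add: psdo_coeff_of_symbol)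
  ultimately have D: "D = Q * psdo_x" using Q(3) by simp
  have "psdo_act Q ` W0 \<subseteq> W0"
    using psdo_act_times_x_power_W0[OF Q(1), of 1] assms(3) by (simp add: D)
  thus ?thesis using that Q D by blast
qed

text \<open>The set \<open>I\<close> of all such operators is closed under division by
  \<open>x\<close>. If all members have order at most \<open>-j\<close>, their coefficients in
  degree \<open>-j\<close> are therefore divisible by every power of \<open>x\<close>, hence 0, and
  the common bound drops by one. The claim is made for all of \<open>I\<close> at once because the
  quotient is another member.\<close>

lemma psdo_stabilizer_eq_0:
  fixes D :: "'k::field_char_0 psdo"
  assumes "D \<in> psdo_E" "psdo_le (-1) D" "psdo_act D ` W0 \<subseteq> W0"
  shows "D = 0"
proof -
  define I where "I = {D :: 'k psdo. D \<in> psdo_E \<and> psdo_le (-1) D \<and> psdo_act D ` W0 \<subseteq> W0}"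
  have "\<forall>D\<in>I. psdo_le (- int j) D" for j
  proof (induction j)
    case 0
    show ?case unfolding I_def using psdo_le_mono[of "-1" _ 0] by auto
  next
    case (Suc j)
    define m where "m = - int j"
    have nth: "\<forall>D\<in>I. \<forall>i < int n. fls_nth (psdo_coeff D m) i = 0" for n
    proof (induction n)
      case 0
      have "psdo_coeff D m \<in> range fps_to_fls" if "D \<in> I" for D
        using that by (simp add: I_def psdo_E_def)
      thus ?case by (simp add: range_fps_to_fls_iff)
    next
      case (Suc n)
      show ?case
      proof (intro ballI allI impI)
        fix D i assume D: "D \<in> I" and i: "i < int (Suc n)"
        have "D \<in> psdo_E" "psdo_le (-1) D" "psdo_act D ` W0 \<subseteq> W0" using D by (simp_all add: I_def)
        then obtain Q where "Q \<in> psdo_E" "psdo_le (-1) Q" "psdo_act Q ` W0 \<subseteq> W0" "D = Q * psdo_x"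
          by (rule psdo_stabilizer_divisible)
        hence Q: "Q \<in> I" "D = Q * psdo_x" by (simp_all add: I_def)
        \<comment> \<open>\<open>m\<close> is the top degree allowed in \<open>I\<close>, so the
          derivative term of \<open>Q x\<close> drops out and the coefficient of \<open>D\<close> is
          \<open>x\<close> times that of \<open>Q\<close>.\<close>
        have "psdo_coeff Q (m + 1) = 0"
          using \<open>\<forall>D\<in>I. psdo_le (- int j) D\<close> Q(1) by (auto simp: psdo_le_def m_def)
        hence "fls_nth (psdo_coeff D m) i = fls_nth (psdo_coeff Q m) (i - 1)"
          by (simp add: Q(2) psdo_coeff_times_x fls_X_times_conv_shift)
        thus "fls_nth (psdo_coeff D m) i = 0" using Suc Q(1) i by simp
      qed
    qed
    show ?case
    proof
      fix D assume D: "D \<in> I"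
      have "fls_nth (psdo_coeff D m) i = 0" for i
        using nth[of "nat (i + 1)"] D by auto
      hence "psdo_coeff D m = 0" by (intro fls_eqI) simp
      moreover have "psdo_le m D" using Suc D by (simp add: m_def)
      ultimately show "psdo_le (- int (Suc j)) D"
        unfolding psdo_le_def
      proof (intro allI impI)
        fix i assume "- int (Suc j) < i"
        hence "i = m \<or> m < i" by (auto simp: m_def)
        thus "psdo_coeff D i = 0" using \<open>psdo_coeff D m = 0\<close> \<open>psdo_le m D\<close> by (auto simp: psdo_le_def)
      qed
    qed
  qed
  thus ?thesis using assms by (intro psdo_eq_0I) (auto simp: I_def)
qed

section \<open>Comparison of two quasiregular operators\<close>

lemma psdo_le_of_fls: "psdo_le 0 (psdo_of_fls a)"
  by (simp add: psdo_le_def psdo_coeff_of_fls)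

text \<open>\<open>x\<close> is a unit among all operators, although not in
  \<open>E\<close>.\<close>

lemma psdo_x_power_cancel:
  "psdo_x ^ n * P = 0 \<longleftrightarrow> P = 0" "P * psdo_x ^ n = 0 \<longleftrightarrow> P = (0 :: 'k::field_char_0 psdo)"
proof -
  let ?y = "psdo_of_fls (inverse (fls_X ^ n)) :: 'k psdo"
  have y: "?y * psdo_x ^ n = 1" "psdo_x ^ n * ?y = 1"
    unfolding psdo_of_fls_power[symmetric] psdo_of_fls_mult[symmetric]
    by (simp_all only: left_inverse[OF fls_X_pow_nonzero] right_inverse[OF fls_X_pow_nonzero] psdo_of_fls_1)
  have "P = ?y * (psdo_x ^ n * P)" by (simp only: y(1) mult_1_left flip: mult.assoc)
  thus "psdo_x ^ n * P = 0 \<longleftrightarrow> P = 0" by auto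
  have "P = (P * psdo_x ^ n) * ?y" by (simp only: y(2) mult_1_right mult.assoc)
  thus "P * psdo_x ^ n = 0 \<longleftrightarrow> P = 0" by auto
qed

lemma quasiregular_eqI:
  fixes S T :: "'k::field_char_0 psdo"
  assumes S: "S \<in> quasiregular" "psdo_inverse S * psdo_x ^ n \<in> psdo_E"
    and T: "T \<in> quasiregular" "psdo_inverse T * psdo_x ^ p \<in> psdo_E"
    and eq: "psdo_act (psdo_inverse S * psdo_x ^ n) ` W0 = psdo_act (psdo_inverse T * psdo_x ^ p) ` W0"
  shows "S = T"
proof -
  have "S \<in> monic0" "T \<in> monic0" using S T by (simp_all add: quasiregular_def)
  note inv = psdo_inverse_monic0[OF \<open>S \<in> monic0\<close>] psdo_inverse_monic0[OF \<open>T \<in> monic0\<close>]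
  \<comment> \<open>\<open>x^a\<close> clears the denominators of \<open>T\<close> from the left, as
    \<open>x^n\<close> does those of the inverse of \<open>S\<close> from the right; this puts
    \<open>C\<close> into \<open>E\<close>.\<close>
  obtain a where a: "psdo_x ^ a * T \<in> psdo_E"
    using T(1) by (auto simp: quasiregular_def psdo_of_fls_power)
  define C where "C = psdo_x ^ a * T * (psdo_inverse S * psdo_x ^ n)"
  define D where "D = C - psdo_x ^ (a + n)"
  have C: "C \<in> psdo_E" unfolding C_def by (intro psdo_E_times a S)
  have D: "D \<in> psdo_E" unfolding D_def by (intro psdo_E_diff C psdo_E_x_power)
  \<comment> \<open>The right factor of \<open>C\<close> maps \<open>v\<close> into the common
    image, where \<open>T^-1 x^p w\<close> represents it; applying \<open>x^a T\<close> gives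
    \<open>x^(a+p) w\<close>.\<close>
  have act_C: "psdo_act C v \<in> W0" if v: "v \<in> W0" for v
  proof -
    obtain w where w: "w \<in> W0"
      "psdo_act (psdo_inverse S * psdo_x ^ n) v = psdo_act (psdo_inverse T * psdo_x ^ p) w"
      using eq v by blast
    have "psdo_act C v = psdo_act (psdo_x ^ a * T) (psdo_act (psdo_inverse T * psdo_x ^ p) w)"
      unfolding C_def psdo_act_times[OF a S(2)] w(2) ..
    also have "\<dots> = psdo_act (psdo_x ^ a * T * (psdo_inverse T * psdo_x ^ p)) w"
      by (rule psdo_act_times[OF a T(2), symmetric])
    also have "psdo_x ^ a * T * (psdo_inverse T * psdo_x ^ p) = psdo_x ^ a * (T * psdo_inverse T) * psdo_x ^ p"
      by (simp only: mult.assoc)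
    also have "\<dots> = psdo_x ^ (a + p)" by (simp add: inv power_add)
    also have "psdo_act (psdo_x ^ (a + p)) w \<in> W0" using w(1) psdo_act_x_power_W0 by blast
    finally show ?thesis .
  qed
  have "psdo_act D v \<in> W0" if v: "v \<in> W0" for v
  proof -
    have "psdo_act (D + psdo_x ^ (a + n)) v = psdo_act D v + psdo_act (psdo_x ^ (a + n)) v"
      by (intro psdo_act_add D psdo_E_x_power)
    hence "psdo_act D v = psdo_act C v - psdo_act (psdo_x ^ (a + n)) v" by (simp add: D_def)
    moreover have "psdo_act (psdo_x ^ (a + n)) v \<in> W0" using v psdo_act_x_power_W0 by blast
    ultimately show ?thesis using act_C[OF v] by (simp add: W0_eq)
  qed
  \<comment> \<open>In this form the order is visibly negative: the leading terms 1 of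
    \<open>T\<close> and \<open>S\<close> cancel.\<close>
  moreover have D_eq: "D = psdo_x ^ a * ((T - S) * psdo_inverse S) * psdo_x ^ n"
  proof -
    have "psdo_x ^ a * (S * psdo_inverse S) * psdo_x ^ n = (psdo_x ^ (a + n) :: 'k psdo)"
      by (simp add: inv power_add)
    moreover have "psdo_x ^ a * ((T - S) * psdo_inverse S) * psdo_x ^ n =
        C - psdo_x ^ a * (S * psdo_inverse S) * psdo_x ^ n"
      by (simp only: C_def left_diff_distrib right_diff_distrib mult.assoc)
    ultimately show ?thesis by (simp only: D_def)
  qed
  moreover have "psdo_le (-1) D"
  proof -
    have "psdo_coeff (T - S) i = 0" if "-1 < i" for i
      using that \<open>S \<in> monic0\<close> \<open>T \<in> monic0\<close>
      by (cases "i = 0") (simp_all add: monic0_def)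
    hence "psdo_le (-1) (T - S)" by (simp add: psdo_le_def)
    hence "psdo_le (0 + ((-1) + 0) + 0) D"
      unfolding D_eq psdo_of_fls_power[symmetric] by (intro psdo_le_times psdo_le_of_fls inv)
    thus ?thesis by simp
  qed
  ultimately have "D = 0" by (intro psdo_stabilizer_eq_0 D) auto
  hence "(T - S) * psdo_inverse S = 0"
    unfolding D_eq by (simp only: psdo_x_power_cancel)
  hence "(T - S) * (psdo_inverse S * S) = 0" by (simp only: mult.assoc[symmetric] mult_zero_left)
  thus ?thesis by (simp add: inv)
qed

text \<open>Of two admissible exponents the larger one differs by a right factor
  \<open>x^(p - m)\<close>, which does not change the image of \<open>W0\<close>; so the chosen
  exponent does not matter.\<close>

lemma sato_gamma_eq:
  fixes S :: "'k::field_char_0 psdo"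
  assumes "psdo_inverse S * psdo_x ^ n \<in> psdo_E"
  shows "sato_gamma S = psdo_act (psdo_inverse S * psdo_x ^ n) ` W0"
proof -
  have le: "psdo_act (psdo_inverse S * psdo_x ^ m) ` W0 = psdo_act (psdo_inverse S * psdo_x ^ p) ` W0"
    if "m \<le> p" "psdo_inverse S * psdo_x ^ m \<in> psdo_E" for m p
  proof -
    have "psdo_inverse S * psdo_x ^ p = psdo_inverse S * psdo_x ^ m * psdo_x ^ (p - m)"
      using that(1) by (simp add: mult.assoc flip: power_add)
    thus ?thesis by (simp add: psdo_act_times_x_power_W0 that(2))
  qed
  define m where "m = (SOME m :: nat. psdo_inverse S * psdo_of_fls (fls_X ^ m) \<in> psdo_E)"
  have m: "psdo_inverse S * psdo_x ^ m \<in> psdo_E"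
    using someI[of "\<lambda>m. psdo_inverse S * psdo_of_fls (fls_X ^ m) \<in> psdo_E" n] assms
    unfolding m_def by (simp add: psdo_of_fls_power)
  have "sato_gamma S = psdo_act (psdo_inverse S * psdo_x ^ m) ` W0"
    unfolding sato_gamma_def m_def[symmetric] by (simp add: psdo_of_fls_power)
  also have "\<dots> = psdo_act (psdo_inverse S * psdo_x ^ n) ` W0"
    using le[OF _ m, of n] le[OF _ assms, of m] by (cases "m \<le> n") (blast, metis nat_le_linear)
  finally show ?thesis .
qed

lemma sato_gamma_inj: "inj_on sato_gamma (quasiregular :: 'k::field_char_0 psdo set)"
proof (rule inj_onI)
  fix S T :: "'k psdo"
  assume ST: "S \<in> quasiregular" "T \<in> quasiregular" "sato_gamma S = sato_gamma T"
  obtain n where n: "psdo_inverse S * psdo_x ^ n \<in> psdo_E"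
    using ST(1) by (auto simp: quasiregular_def psdo_of_fls_power)
  obtain p where p: "psdo_inverse T * psdo_x ^ p \<in> psdo_E"
    using ST(2) by (auto simp: quasiregular_def psdo_of_fls_power)
  show "S = T"
    using quasiregular_eqI[OF ST(1) n ST(2) p] ST(3) sato_gamma_eq[OF n] sato_gamma_eq[OF p] by simp
qed

section \<open>The operators over the projective line\<close>

lemma psdo_of_fls_add: "psdo_of_fls (a + b) = psdo_of_fls a + psdo_of_fls (b :: 'a::field_char_0 fls)"
  by (rule psdo_eqI) (simp add: psdo_coeff_of_fls)

lemma psdo_mono_times_const:
  "psdo_mono a i * psdo_mono (fls_const c) j = psdo_mono (a * fls_const c :: 'k::field_char_0 fls) (i + j)"
proof (rule psdo_eqI)
  fix m
  show "psdo_coeff (psdo_mono a i * psdo_mono (fls_const c) j) m = psdo_coeff (psdo_mono (a * fls_const c) (i + j)) m"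
  proof (cases "m \<le> i + j")
    case True
    hence m: "m = i + j - int (nat (i + j - m))" by simp
    show ?thesis
      by (subst (1 2) m, unfold psdo_coeff_mono_times_mono) (use True in \<open>auto simp: psdo_coeff_mono\<close>)
  next
    case False
    thus ?thesis using psdo_le_times[OF psdo_le_psdo_mono[of i a] psdo_le_psdo_mono[of j "fls_const c"]]
      by (simp add: psdo_le_def psdo_coeff_mono)
  qed
qed

text \<open>\<open>\<partial>^-1 u = u \<partial>^-1 - u' \<partial>^-2\<close> has no further
  terms, because \<open>u'\<close> is constant.\<close>

lemma psdo_mono_times_affine:
  fixes u :: "'k::field_char_0 fls"
  assumes "fls_deriv u = fls_const b"
  shows "psdo_mono c (-1) * psdo_of_fls u = psdo_mono (c * u) (-1) - psdo_mono (c * fls_const b) (-2)"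
proof (rule psdo_eqI)
  fix m
  let ?R = "psdo_mono (c * u) (-1) - psdo_mono (c * fls_const b) (-2)"
  show "psdo_coeff (psdo_mono c (-1) * psdo_of_fls u) m = psdo_coeff ?R m"
  proof (cases "m \<le> -1")
    case True
    define n where "n = nat (- 1 - m)"
    have m: "m = -1 + 0 - int n" using True by (simp add: n_def)
    have "psdo_coeff (psdo_mono c (-1) * psdo_of_fls u) m = (of_int (-1) gchoose n) * c * (fls_deriv ^^ n) u"
      unfolding m psdo_of_fls_eq_mono psdo_coeff_mono_times_mono ..
    also have "\<dots> = psdo_coeff ?R m"
    proof -
      consider "n = 0" | "n = 1" | l where "n = Suc (Suc l)" by (metis One_nat_def not0_implies_Suc)
      thus ?thesis
      proof cases
        case (3 l)
        have "(fls_deriv ^^ n) u = 0" unfolding 3 funpow_Suc_right o_apply assms by simp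
        thus ?thesis using 3 by (simp add: psdo_coeff_mono m)
      qed (simp_all add: psdo_coeff_mono m assms)
    qed
    finally show ?thesis .
  next
    case False
    thus ?thesis using psdo_le_times[OF psdo_le_psdo_mono[of "-1" c] psdo_le_of_fls[of u]]
      by (simp add: psdo_le_def psdo_coeff_mono)
  qed
qed

section \<open>Images of \<open>W0\<close> under affine operators\<close>

lemma fls_nth_psdo_act_affine:
  fixes v :: "'k::field_char_0 fls"
  shows "fls_nth (psdo_act (psdo_of_fls (fls_const a + fls_const b * fls_X)) v) i =
    a * fls_nth v i + b * of_int (i - 1) * fls_nth v (i - 1)"
proof -
  have "psdo_of_fls (fls_const c) \<in> psdo_E" for c :: 'k by (intro psdo_E_of_fls) simp
  thus ?thesis
    by (simp add: psdo_of_fls_add psdo_of_fls_mult psdo_act_add psdo_act_times psdo_E_times psdo_E_x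
        psdo_act_const fls_nth_psdo_act_x)
qed

text \<open>Symbols have constant coefficients, so no derivative terms arise and
  \<open>\<partial>^-1\<close> acts as multiplication by \<open>z\<close>.\<close>

lemma psdo_act_const_d_inverse:
  "psdo_act (psdo_mono (fls_const b) (-1)) v = fls_const (b :: 'k::field_char_0) * (fls_X * v)"
proof (rule psdo_act_eqI[where Q = 0])
  show "psdo_mono (fls_const b) (-1) * psdo_of_symbol v = psdo_of_symbol (fls_const b * (fls_X * v)) + 0 * psdo_x"
  proof (rule psdo_eqI)
    fix m
    obtain q where q: "psdo_le q (psdo_of_symbol v)" using psdo_le_exists by blast
    have "psdo_coeff (psdo_mono (fls_const b) (-1) * psdo_of_symbol v) m =
      (\<Sum>l\<le>nat (q - 1 - m). (of_int (-1) gchoose l) * fls_const b *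
         (fls_deriv ^^ l) (psdo_coeff (psdo_of_symbol v) (m - (-1) + int l)))"
      by (rule psdo_coeff_mono_times[OF q]) simp
    also have "\<dots> = (\<Sum>l\<in>{0}. (of_int (-1) gchoose l) * fls_const b *
         (fls_deriv ^^ l) (psdo_coeff (psdo_of_symbol v) (m - (-1) + int l)))"
      by (rule sum.mono_neutral_right) (auto simp: psdo_coeff_of_symbol)
    finally show "psdo_coeff (psdo_mono (fls_const b) (-1) * psdo_of_symbol v) m =
        psdo_coeff (psdo_of_symbol (fls_const b * (fls_X * v)) + 0 * psdo_x) m"
      by (simp add: psdo_coeff_of_symbol fls_X_times_conv_shift algebra_simps)
  qed
qed (simp add: psdo_E_def range_fps_to_fls_iff)

text \<open>A bidiagonal system, solved upwards from the lowest degree of \<open>w\<close> with one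
  division by \<open>c\<close> per step.\<close>

lemma W0_solve_recurrence:
  fixes w :: "'k::field fls"
  assumes "c \<noteq> 0"
  obtains v where "v \<in> W0" "\<And>i. i \<le> 0 \<Longrightarrow> c * fls_nth v i + e i * fls_nth v (i - 1) = fls_nth w i"
proof -
  define N where "N = min 0 (fls_subdegree w)"
  \<comment> \<open>The indices are shifted by one: \<open>y 0 = 0\<close> sits in degree
    \<open>N - 1\<close> and \<open>y (Suc j)\<close> in degree \<open>N + j\<close>.\<close>
  define y where "y = rec_nat 0 (\<lambda>j z. (fls_nth w (N + int j) - e (N + int j) * z) / c)"
  have y: "y 0 = 0" "y (Suc j) = (fls_nth w (N + int j) - e (N + int j) * y j) / c" for j
    by (simp_all add: y_def)
  obtain v where v: "\<And>i. fls_nth v i = (if N - 1 \<le> i \<and> i \<le> 0 then y (nat (i - (N - 1))) else 0)"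
    by (rule fls_exists_nth[of "N - 1" "\<lambda>i. if N - 1 \<le> i \<and> i \<le> 0 then y (nat (i - (N - 1))) else 0"]) auto
  have "c * fls_nth v i + e i * fls_nth v (i - 1) = fls_nth w i" if "i \<le> 0" for i
  proof (cases "N \<le> i")
    case True
    define j where "j = nat (i - N)"
    have i: "i = N + int j" using True by (simp add: j_def)
    have "nat (i - (N - 1)) = Suc j" "nat (i - 1 - (N - 1)) = j" by (simp_all add: i)
    hence "fls_nth v i = y (Suc j)" "fls_nth v (i - 1) = y j" using that True by (simp_all add: v)
    thus ?thesis using assms by (simp add: y i)
  next
    case False
    hence "fls_nth w i = 0" by (intro fls_eq0_below_subdegree) (simp add: N_def)
    moreover have "fls_nth v i = 0" "fls_nth v (i - 1) = 0"
      using False by (cases "i = N - 1", simp_all add: v y(1))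
    ultimately show ?thesis by simp
  qed
  thus ?thesis using that[of v] by (simp add: W0_eq v)
qed

text \<open>\<open>z^j\<close> goes to \<open>a z^j + b j z^(j+1)\<close>; for \<open>j = 0\<close>
  the second term, which would leave \<open>W0\<close>, has factor 0. Solving for a preimage is a
  recurrence with diagonal entry \<open>a\<close>.\<close>

lemma psdo_act_affine_W0:
  fixes a b :: "'k::field_char_0"
  assumes "a \<noteq> 0"
  shows "psdo_act (psdo_of_fls (fls_const a + fls_const b * fls_X)) ` W0 = W0"
proof
  let ?act = "psdo_act (psdo_of_fls (fls_const a + fls_const b * fls_X))"
  have gt: "fls_nth (?act v) i = 0" if "v \<in> W0" "0 < i" for v i
    unfolding fls_nth_psdo_act_affine using that by (cases "i = 1") (simp_all add: W0_eq)
  thus "?act ` W0 \<subseteq> W0" unfolding W0_eq by blast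
  show "W0 \<subseteq> ?act ` W0"
  proof
    fix w :: "'k fls" assume w: "w \<in> W0"
    obtain v where v: "v \<in> W0"
      "\<And>i. i \<le> 0 \<Longrightarrow> a * fls_nth v i + b * of_int (i - 1) * fls_nth v (i - 1) = fls_nth w i"
      using W0_solve_recurrence[OF assms, of "\<lambda>i. b * of_int (i - 1)" w] by blast
    have "?act v = w"
    proof (rule fls_eqI)
      fix i
      show "fls_nth (?act v) i = fls_nth w i"
      proof (cases "i \<le> 0")
        case True
        thus ?thesis unfolding fls_nth_psdo_act_affine by (rule v(2))
      next
        case False
        thus ?thesis using gt[OF v(1), of i] w by (simp add: W0_eq)
      qed
    qed
    thus "w \<in> ?act ` W0" using v(1) by blast
  qed
qed

lemma W_line_as_image:
  fixes a b :: "'k::field_char_0"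
  assumes "(a, b) \<noteq> (0, 0)"
  defines "A \<equiv> psdo_of_fls (fls_const a + fls_const b * fls_X) + psdo_mono (fls_const b) (-1)"
  shows "A \<in> psdo_E" "psdo_act A ` W0 = W_line a b"
proof -
  have E: "psdo_of_fls (fls_const a + fls_const b * fls_X) \<in> psdo_E" "psdo_mono (fls_const b) (-1) \<in> psdo_E"
    by (simp_all add: psdo_E_def range_fps_to_fls_iff psdo_coeff_of_fls psdo_coeff_mono)
  thus "A \<in> psdo_E" unfolding A_def by (rule psdo_E_add)
  have act: "fls_nth (psdo_act A v) i = a * fls_nth v i + b * of_int i * fls_nth v (i - 1)" for v i
  proof -
    have "fls_nth (fls_const b * (fls_X * v)) i = b * fls_nth v (i - 1)"
      by (simp add: fls_X_times_conv_shift(1)[of v])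
    thus ?thesis
      by (simp add: A_def psdo_act_add E fls_nth_psdo_act_affine psdo_act_const_d_inverse)
         (simp add: algebra_simps)
  qed
  show "psdo_act A ` W0 = W_line a b"
  proof
    show "psdo_act A ` W0 \<subseteq> W_line a b"
    proof (rule image_subsetI)
      fix v :: "'k fls" assume v: "v \<in> W0"
      hence "fls_nth (psdo_act A v) 0 = fls_nth v 0 * a" "fls_nth (psdo_act A v) 1 = fls_nth v 0 * b"
        "\<forall>i\<ge>2. fls_nth (psdo_act A v) i = 0"
        by (simp_all add: act W0_eq)
      thus "psdo_act A v \<in> W_line a b" unfolding W_line_eq by blast
    qed
    show "W_line a b \<subseteq> psdo_act A ` W0"
    proof
      fix w assume "w \<in> W_line a b"
      then obtain t where w: "fls_nth w 0 = t * a" "fls_nth w 1 = t * b" "\<And>i. i \<ge> 2 \<Longrightarrow> fls_nth w i = 0"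
        unfolding W_line_eq by blast
      obtain v where v: "v \<in> W0" "\<And>i. i \<le> 1 \<Longrightarrow> a * fls_nth v i + b * of_int i * fls_nth v (i - 1) = fls_nth w i"
      proof (cases "a = 0")
        case True
        hence b: "b \<noteq> 0" using assms(1) by simp
        \<comment> \<open>For \<open>i = -1\<close> the denominator is 0 and the quotient is 0 by
          convention. This is harmless: the equation in degree 0 only says
          \<open>fls_nth w 0 = 0\<close>, which holds as \<open>a = 0\<close>.\<close>
        obtain v where v: "\<And>i. fls_nth v i = (if i \<le> 0 then fls_nth w (i + 1) / (b * of_int (i + 1)) else 0)"
          by (rule fls_exists_nth[of "min 0 (fls_subdegree w - 1)"
                "\<lambda>i. if i \<le> 0 then fls_nth w (i + 1) / (b * of_int (i + 1)) else 0"]) auto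
        have "a * fls_nth v i + b * of_int i * fls_nth v (i - 1) = fls_nth w i" if "i \<le> 1" for i
          using that b w(1) True by (cases "i = 0") (simp_all add: v)
        thus ?thesis using that[of v] by (simp add: W0_eq v)
      next
        case False
        obtain v where v: "v \<in> W0"
          "\<And>i. i \<le> 0 \<Longrightarrow> a * fls_nth v i + b * of_int i * fls_nth v (i - 1) = fls_nth w i"
          using W0_solve_recurrence[OF False, of "\<lambda>i. b * of_int i" w] by blast
        \<comment> \<open>The recurrence stops at degree 0, where it forces the value
          \<open>t\<close>; the remaining equation in degree 1 then holds because \<open>w\<close>
          has coefficient \<open>t * b\<close> there.\<close>
        have "fls_nth v 0 = t" using v(2)[of 0] False w(1) by simp
        hence "a * fls_nth v 1 + b * of_int 1 * fls_nth v (1 - 1) = fls_nth w 1"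
          using w(2) v(1) by (simp add: W0_eq)
        hence "a * fls_nth v i + b * of_int i * fls_nth v (i - 1) = fls_nth w i" if "i \<le> 1" for i
          using v(2)[of i] that by (cases "i = 1") simp_all
        thus ?thesis using that[of v] v(1) by blast
      qed
      have "psdo_act A v = w"
      proof (rule fls_eqI)
        fix i
        show "fls_nth (psdo_act A v) i = fls_nth w i"
          using v w(3)[of i] by (cases "i \<le> 1") (simp_all add: act W0_eq)
      qed
      thus "w \<in> psdo_act A ` W0" using v(1) by blast
    qed
  qed
qed

text \<open>With \<open>u = a + b x\<close> nonzero, this is
  \<open>u \<partial> u^-1 \<partial>^-1\<close>.\<close>

definition line_operator :: "'k::field_char_0 \<Rightarrow> 'k \<Rightarrow> 'k psdo" where
  "line_operator a b = 1 - psdo_mono (fls_const b / (fls_const a + fls_const b * fls_X)) (-1)"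

text \<open>The terms in \<open>\<partial>^-1\<close> cancel by \<open>(b / u) u = b\<close>. Those
  in \<open>\<partial>^-2\<close>, from moving \<open>\<partial>^-1\<close> past \<open>u\<close>
  and from the product with \<open>b \<partial>^-1\<close>, are opposite.\<close>

lemma line_operator_times:
  fixes a b :: "'k::field_char_0"
  assumes "(a, b) \<noteq> (0, 0)"
  defines "u \<equiv> fls_const a + fls_const b * fls_X"
  shows "line_operator a b * (psdo_of_fls u + psdo_mono (fls_const b) (-1)) = psdo_of_fls u"
    and "u \<noteq> 0"
proof -
  have "fls_nth u 0 = a" "fls_nth u 1 = b" by (simp_all add: u_def)
  thus "u \<noteq> 0" using assms(1) by auto
  hence cu: "fls_const b / u * u = fls_const b" by simp
  have "fls_deriv u = fls_const b" by (simp add: u_def)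
  note aff = psdo_mono_times_affine[OF this, of "fls_const b / u"]
  show "line_operator a b * (psdo_of_fls u + psdo_mono (fls_const b) (-1)) = psdo_of_fls u"
    unfolding line_operator_def u_def[symmetric] left_diff_distrib distrib_left aff cu psdo_mono_times_const
    by simp
qed

lemma line_operator_monic0: "line_operator a b \<in> monic0"
  by (simp add: monic0_def line_operator_def psdo_coeff_one psdo_coeff_mono)

lemma fls_inverse_affine:
  fixes c d :: "'k::field_char_0"
  assumes "c \<noteq> 0"
  shows "inverse (fls_const c + fls_const d * fls_X) \<in> range fps_to_fls"
    and "fls_nth (inverse (fls_const c + fls_const d * fls_X)) 0 = inverse c"
proof -
  define h where "h = fps_const c + fps_const d * fps_X"
  have h: "fls_const c + fls_const d * fls_X = fps_to_fls h"
    by (simp add: h_def fls_times_fps_to_fls)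
  have "fps_nth h 0 \<noteq> 0" using assms by (simp add: h_def)
  hence "inverse (fps_to_fls h) = fps_to_fls (inverse h)" by (intro fls_inverse_fps_to_fls) simp
  thus "inverse (fls_const c + fls_const d * fls_X) \<in> range fps_to_fls"
    "fls_nth (inverse (fls_const c + fls_const d * fls_X)) 0 = inverse c"
    by (simp_all add: h) (simp add: h_def)
qed

lemma line_operator_properties:
  fixes a b :: "'k::field_char_0"
  assumes ab: "(a, b) \<noteq> (0, 0)"
  shows "line_operator a b \<in> quasiregular"
    and "sato_gamma (line_operator a b) = W_line a b"
    and "psdo_coord (-1) 1 (line_operator a b) = (if a \<noteq> 0 then 0 else -1)"
    and "psdo_coord 0 1 (line_operator a b) = (if a \<noteq> 0 then - b / a else 0)"
proof -
  let ?S = "line_operator a b"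
  define u where "u = fls_const a + fls_const b * fls_X"
  define A where "A = psdo_of_fls u + psdo_mono (fls_const b) (-1)"
  note SA = line_operator_times[OF ab, folded u_def, folded A_def]
  note A = W_line_as_image[OF ab, folded u_def, folded A_def]
  \<comment> \<open>\<open>n\<close> is the order of vanishing of \<open>u\<close> at
    \<open>x = 0\<close>: for \<open>a = 0\<close>, \<open>u\<close> is \<open>b x\<close>. The
    other factor of \<open>u\<close> is a unit of \<open>k[[x]]\<close>.\<close>
  define n :: nat where "n = (if a = 0 then 1 else 0)"
  obtain c d where cd: "c \<noteq> 0" "u = (fls_const c + fls_const d * fls_X) * fls_X ^ n"
  proof (cases "a = 0")
    case True
    thus ?thesis using that[of b 0] ab by (simp add: u_def n_def)
  next
    case False
    thus ?thesis using that[of a b] by (simp add: u_def n_def)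
  qed
  define g where "g = fls_const c + fls_const d * fls_X"
  have "fls_nth g 0 = c" by (simp add: g_def)
  hence "g \<noteq> 0" using cd(1) by auto
  have g: "psdo_of_fls g \<in> psdo_E" "psdo_of_fls (inverse g) \<in> psdo_E"
    using fls_inverse_affine(1)[OF cd(1), of d]
    by (auto intro!: psdo_E_of_fls simp: g_def) (simp add: range_fps_to_fls_iff)
  have u: "u = g * fls_X ^ n" using cd(2) by (simp add: g_def)
  have inv_u: "inverse u * fls_X ^ n = inverse g" using SA(2) by (simp add: u field_simps del: fls_inverse_X_power)
  note inv = psdo_inverse_monic0[OF line_operator_monic0[of a b]]
  have "?S * (A * psdo_of_fls (inverse u)) = psdo_of_fls (u * inverse u)"
    unfolding mult.assoc[symmetric] SA(1) psdo_of_fls_mult ..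
  also have "\<dots> = 1" using SA(2) by (simp add: psdo_of_fls_1)
  finally have "psdo_inverse ?S * (?S * (A * psdo_of_fls (inverse u))) = psdo_inverse ?S" by simp
  hence "psdo_inverse ?S = A * psdo_of_fls (inverse u)"
    unfolding mult.assoc[symmetric] inv(2) by simp
  \<comment> \<open>Multiplication by \<open>x^n\<close> turns \<open>u^-1\<close>, which may have a
    pole, into the integral \<open>g^-1\<close>.\<close>
  hence S_inv: "psdo_inverse ?S * psdo_x ^ n = A * psdo_of_fls (inverse g)"
    by (simp only: mult.assoc psdo_of_fls_power[symmetric] psdo_of_fls_mult[symmetric] inv_u)
  hence E: "psdo_inverse ?S * psdo_x ^ n \<in> psdo_E" using A(1) g(2) by (simp add: psdo_E_times)
  have b_u: "fls_const b / u * fls_X ^ n = fls_const b * inverse g"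
    using inv_u by (simp add: divide_inverse mult.assoc del: fls_inverse_X_power)
  have "psdo_x ^ n * ?S \<in> psdo_E"
  proof -
    have "fls_X ^ n * (fls_const b / u) \<in> range fps_to_fls"
      using b_u fls_inverse_affine(1)[OF cd(1), of d]
      by (simp only: mult.commute g_def) (intro range_fps_to_fls_mult; simp)
    thus ?thesis
      unfolding psdo_E_def psdo_of_fls_power[symmetric]
      by (simp add: line_operator_def u_def[symmetric] psdo_coeff_one psdo_coeff_mono right_diff_distrib
          psdo_coeff_of_fls range_fps_to_fls_iff)
  qed
  thus "?S \<in> quasiregular"
    using E line_operator_monic0 by (auto simp: quasiregular_def psdo_of_fls_power)
  have "sato_gamma ?S = psdo_act (A * psdo_of_fls (inverse g)) ` W0"
    using sato_gamma_eq[OF E] S_inv by simp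
  \<comment> \<open>\<open>W0\<close> is replaced by its image under \<open>g\<close>, which equals
    \<open>W0\<close>, in order to cancel \<open>g^-1\<close>.\<close>
  also have "\<dots> = psdo_act (A * psdo_of_fls (inverse g)) ` psdo_act (psdo_of_fls g) ` W0"
    using psdo_act_affine_W0[OF cd(1), of d] by (simp add: g_def)
  also have "\<dots> = psdo_act (A * psdo_of_fls (inverse g) * psdo_of_fls g) ` W0"
    unfolding image_image by (simp add: psdo_act_times psdo_E_times A(1) g)
  also have "A * psdo_of_fls (inverse g) * psdo_of_fls g = A"
    using \<open>g \<noteq> 0\<close> by (simp add: mult.assoc psdo_of_fls_1 flip: psdo_of_fls_mult)
  finally show "sato_gamma ?S = W_line a b" using A(2) by simp
  have S1: "psdo_coeff ?S (- int 1) = - (fls_const b / u)"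
    by (simp add: line_operator_def u_def psdo_coeff_one psdo_coeff_mono)
  have "psdo_coord (-1) 1 ?S = (if a \<noteq> 0 then 0 else -1) \<and>
      psdo_coord 0 1 ?S = (if a \<noteq> 0 then - b / a else 0)"
  proof (cases "a = 0")
    case True
    hence "b \<noteq> 0" using ab by simp
    have "fls_const b / u = (fls_const b * 1) / (fls_const b * fls_X)" using True by (simp add: u_def)
    also have "\<dots> = 1 / fls_X" by (rule mult_divide_mult_cancel_left) (use \<open>b \<noteq> 0\<close> in simp)
    also have "\<dots> = fls_X_inv" by (simp only: divide_inverse fls_inverse_X mult_1_left)
    finally have "fls_const b / u = fls_X_inv" .
    thus ?thesis
      using True unfolding psdo_coord_def S1 by simp
  next
    case False
    note * = fls_inverse_affine[OF False, of b, folded u_def]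
    have "fls_nth (inverse u) (-1) = 0" using *(1) by (simp add: range_fps_to_fls_iff)
    thus ?thesis
      using False *(2) unfolding psdo_coord_def S1 by (simp add: divide_inverse)
  qed
  thus "psdo_coord (-1) 1 ?S = (if a \<noteq> 0 then 0 else -1)"
    "psdo_coord 0 1 ?S = (if a \<noteq> 0 then - b / a else 0)" by blast+
qed

lemma sato_gamma_inv_W_line:
  "(a, b) \<noteq> (0, 0) \<Longrightarrow> sato_gamma_inv (W_line a b) = line_operator a (b :: 'k::field_char_0)"
  unfolding sato_gamma_inv_def
  by (rule the_inv_into_f_eq[OF sato_gamma_inj]) (simp_all add: line_operator_properties)

section \<open>The projective line in the Grassmannian\<close>

lemma has_quotient_dim_0: "A \<subseteq> U \<Longrightarrow> has_quotient_dim sc A U 0"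
  unfolding has_quotient_dim_def by (rule exI[of _ "{}"]) auto

text \<open>An extensional function on \<open>{b}\<close> is determined by its value at
  \<open>b\<close>, so coordinates reduce to one scalar.\<close>

lemma has_quotient_dim_1:
  assumes "b \<in> A" "\<And>v. v \<in> A \<Longrightarrow> \<exists>!c. v - sc c b \<in> U"
  shows "has_quotient_dim sc A U 1"
  unfolding has_quotient_dim_def
proof (intro exI[of _ "{b}"] conjI ballI)
  fix v assume "v \<in> A"
  then obtain c where c: "v - sc c b \<in> U" "\<And>c'. v - sc c' b \<in> U \<Longrightarrow> c' = c" using assms(2) by blast
  show "\<exists>!c. c \<in> {b} \<rightarrow>\<^sub>E UNIV \<and> v - (\<Sum>b\<in>{b}. sc (c b) b) \<in> U"
  proof (rule ex1I[of _ "\<lambda>x\<in>{b}. c"])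
    fix f assume f: "f \<in> {b} \<rightarrow>\<^sub>E UNIV \<and> v - (\<Sum>b\<in>{b}. sc (f b) b) \<in> U"
    have "f b = c" by (rule c(2)) (use f in simp)
    moreover have "f \<in> extensional {b}" using f by (simp add: PiE_iff)
    ultimately show "f = (\<lambda>x\<in>{b}. c)" by (intro extensionalityI[of _ "{b}"]) simp_all
  qed (use c(1) in simp)
qed (use assms(1) in auto)

text \<open>Positive degrees are absorbed by \<open>zkz\<close> and negative ones by the line space,
  so only degree 0 is constrained.\<close>

lemma W_line_plus_zkz:
  fixes a b :: "'k::field"
  shows "{w + u | w u. w \<in> W_line a b \<and> u \<in> zkz} = {v. \<exists>t. fls_nth v 0 = t * a}"
proof (intro equalityI subsetI)
  fix v assume "v \<in> {v. \<exists>t. fls_nth v 0 = t * a}"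
  then obtain t where t: "fls_nth v 0 = t * a" by blast
  \<comment> \<open>In degree 1 the generator already contributes \<open>t * b\<close>;
    \<open>u\<close> supplies the difference.\<close>
  define f where "f = (\<lambda>i. if i \<ge> 2 then fls_nth v i else if i = 1 then fls_nth v 1 - t * b else 0)"
  have "f i = 0" if "i < 0" for i using that by (simp add: f_def)
  then obtain u where u: "\<And>i. fls_nth u i = f i" by (rule fls_exists_nth) auto
  have "v - u \<in> W_line a b" "u \<in> zkz"
    unfolding W_line_eq zkz_def using t by (auto simp: u f_def)
  thus "v \<in> {w + u | w u. w \<in> W_line a b \<and> u \<in> zkz}" by force
qed (auto simp: W_line_eq zkz_def)

text \<open>For \<open>a = 0\<close> the kernel is spanned by \<open>(z, -z)\<close> and the
  cokernel by the class of 1; for other \<open>a\<close> both are zero.\<close>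

lemma W_line_in_Gr0:
  fixes a b :: "'k::field"
  assumes "(a, b) \<noteq> (0, 0)"
  shows "W_line a b \<in> Gr0"
proof -
  let ?K = "{(w, u). w \<in> W_line a b \<and> u \<in> zkz \<and> w + u = 0}"
  let ?I = "{w + u | w u. w \<in> W_line a b \<and> u \<in> zkz}"
  have K: "\<exists>t. fls_nth w 0 = t * a \<and> (\<forall>i. fls_nth w i = (if i = 1 then t * b else 0)) \<and> u = - w"
    if "(w, u) \<in> ?K" for w u
  proof -
    have "w \<in> W_line a b" using that by simp
    then obtain t where t: "fls_nth w 0 = t * a" "fls_nth w 1 = t * b" "\<And>i. i \<ge> 2 \<Longrightarrow> fls_nth w i = 0"
      unfolding W_line_eq by blast
    have u: "u = - w" using that by (simp add: eq_neg_iff_add_eq_0 add.commute)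
    hence "fls_nth w i = 0" if "i \<le> 0" for i using \<open>(w, u) \<in> ?K\<close> that by (auto simp: zkz_def)
    moreover have "i \<le> 0 \<or> i = 1 \<or> i \<ge> 2" for i :: int by linarith
    ultimately show ?thesis using t u by (metis numeral_le_one_iff semiring_norm(69) not_one_le_zero)
  qed
  have "\<exists>d. has_quotient_dim scaleVV ?K {0} d \<and> has_quotient_dim scaleV UNIV ?I d"
  proof (cases "a = 0")
    case True
    hence b: "b \<noteq> 0" using assms by simp
    have "has_quotient_dim scaleVV ?K {0} 1"
    proof (rule has_quotient_dim_1)
      show "(fls_X, - fls_X) \<in> ?K"
        using b True by (auto simp: W_line_eq zkz_def intro!: exI[of _ "inverse b"])
      fix p assume p: "p \<in> ?K"
      obtain w u where wu: "p = (w, u)" by (cases p)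
      obtain t where t: "\<And>i. fls_nth w i = (if i = 1 then t * b else 0)" "u = - w"
        using K p wu by blast
      show "\<exists>!c. p - scaleVV c (fls_X, - fls_X) \<in> {0}"
      proof (rule ex1I[of _ "t * b"])
        have "w = scaleV (t * b) fls_X" by (rule fls_eqI) (simp add: t)
        thus "p - scaleVV (t * b) (fls_X, - fls_X) \<in> {0}"
          by (simp add: wu t(2) scaleVV_def zero_prod_def)
        fix c assume "p - scaleVV c (fls_X, - fls_X) \<in> {0}"
        hence "w = scaleV c fls_X" by (simp add: wu scaleVV_def zero_prod_def)
        hence "fls_nth w 1 = c" by simp
        thus "c = t * b" by (simp add: t)
      qed
    qed
    moreover have "has_quotient_dim scaleV UNIV ?I 1"
    proof (rule has_quotient_dim_1[of 1])
      fix v :: "'k fls"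
      show "\<exists>!c. v - scaleV c 1 \<in> ?I"
        unfolding W_line_plus_zkz by (rule ex1I[of _ "fls_nth v 0"]) (auto simp: True)
    qed simp
    ultimately show ?thesis by blast
  next
    case False
    have "?K \<subseteq> {0}"
    proof
      fix p assume p: "p \<in> ?K"
      obtain w u where wu: "p = (w, u)" by (cases p)
      obtain t where t: "fls_nth w 0 = t * a" "\<And>i. fls_nth w i = (if i = 1 then t * b else 0)" "u = - w"
        using K p wu by blast
      have "t = 0" using t(1) t(2)[of 0] False by simp
      hence "w = 0" by (intro fls_eqI) (simp add: t)
      thus "p \<in> {0}" using t(3) by (simp add: wu zero_prod_def)
    qed
    moreover have "UNIV \<subseteq> ?I"
    proof
      fix v :: "'k fls"
      have "fls_nth v 0 = fls_nth v 0 / a * a" using False by simp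
      thus "v \<in> ?I" unfolding W_line_plus_zkz by blast
    qed
    ultimately show ?thesis by (intro exI[of _ 0] conjI has_quotient_dim_0)
  qed
  moreover have "scaleV.subspace (W_line a b)" unfolding W_line_def by (rule scaleV.subspace_span)
  ultimately show ?thesis by (simp add: Gr0_def)
qed

section \<open>Parametrization of \<open>R\<close> by the projective line\<close>

lemma P1_point_eq: "v \<noteq> (0, 0) \<Longrightarrow> P1_point v = {(c * fst v, c * snd v) | c. c \<noteq> 0}"
  unfolding P1_point_def proj_rel_def by (cases v) (simp add: Image_singleton set_eq_iff conj_ac)

lemma P1_eq: "P1 = P1_point ` (UNIV - {(0, 0 :: 'k::field)})"
  by (simp add: P1_def P1_point_def quotient_def UNION_singleton_eq_range)

lemma W_line_scale:
  assumes "c \<noteq> 0"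
  shows "W_line (c * a) (c * b) = W_line a (b :: 'k::field)"
proof -
  have *: "(\<exists>t. x = t * (c * a) \<and> y = t * (c * b)) \<longleftrightarrow> (\<exists>t. x = t * a \<and> y = t * b)" for x y
  proof
    assume "\<exists>t. x = t * a \<and> y = t * b"
    then obtain t where "x = t * a" "y = t * b" by blast
    thus "\<exists>t. x = t * (c * a) \<and> y = t * (c * b)" using assms by (intro exI[of _ "t / c"]) simp
  next
    assume "\<exists>t. x = t * (c * a) \<and> y = t * (c * b)"
    then obtain t where "x = t * (c * a)" "y = t * (c * b)" by blast
    hence "x = t * c * a" "y = t * c * b" by (simp_all only: mult.assoc)
    thus "\<exists>t. x = t * a \<and> y = t * b" by blast
  qed
  show ?thesis unfolding W_line_eq by (intro Collect_cong conj_cong refl *)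
qed

lemma W_at_P1_point:
  assumes "(a, b) \<noteq> (0, 0)"
  shows "W_at (P1_point (a, b)) = W_line a (b :: 'k::field)"
proof -
  have "the_elem ((\<lambda>(a, b). W_line a b) ` P1_point (a, b)) = (\<lambda>(a, b). W_line a b) (a, b)"
  proof (rule the_elem_image_unique)
    have "(1 * a, 1 * b) \<in> P1_point (a, b)"
      unfolding P1_point_eq[OF assms] fst_conv snd_conv by (intro CollectI exI[of _ 1]) simp
    thus "P1_point (a, b) \<noteq> {}" by blast
  next
    fix v assume "v \<in> P1_point (a, b)"
    then obtain c where "c \<noteq> 0" "v = (c * a, c * b)" unfolding P1_point_eq[OF assms] by auto
    thus "(\<lambda>(a, b). W_line a b) v = (\<lambda>(a, b). W_line a b) (a, b)" by (simp add: W_line_scale)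
  qed
  thus ?thesis by (simp add: W_at_def)
qed

text \<open>The generator of the first space lies in the second, and its coefficients in degrees 0
  and 1 give the factor \<open>t\<close>.\<close>

lemma W_line_eq_imp:
  assumes "W_line a b = W_line a' (b' :: 'k::field)" "(a, b) \<noteq> (0, 0)"
  obtains t where "t \<noteq> 0" "a = t * a'" "b = t * b'"
proof -
  have "fls_const a + fls_const b * fls_X \<in> W_line a b"
    unfolding W_line_def by (intro scaleV.span_base) blast
  hence "\<exists>t. a = t * a' \<and> b = t * b'" unfolding assms(1) unfolding W_line_eq by simp
  then obtain t where "a = t * a'" "b = t * b'" by blast
  thus ?thesis using assms(2) that[of t] by auto
qed

lemma P1_cases:
  assumes "p \<in> P1"
  obtains a b :: "'k::field" where "(a, b) \<noteq> (0, 0)" "p = P1_point (a, b)"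
proof -
  obtain v where "v \<noteq> (0, 0)" "p = P1_point v" using assms unfolding P1_eq by blast
  thus ?thesis using that[of "fst v" "snd v"] by simp
qed

lemma bij_betw_W_at: "bij_betw W_at P1 (projective_R :: 'k::field fls set set)"
proof (rule bij_betw_imageI)
  show "inj_on W_at (P1 :: ('k \<times> 'k) set set)"
  proof (rule inj_onI)
    fix p q :: "('k \<times> 'k) set"
    assume p: "p \<in> P1" and q: "q \<in> P1" and "W_at p = W_at q"
    obtain a b where ab: "(a, b) \<noteq> (0, 0)" "p = P1_point (a, b)" using p by (rule P1_cases)
    obtain a' b' where ab': "(a', b') \<noteq> (0, 0)" "q = P1_point (a', b')" using q by (rule P1_cases)
    have "W_line a b = W_line a' b'" using \<open>W_at p = W_at q\<close> unfolding ab(2) ab'(2) W_at_P1_point[OF ab(1)] W_at_P1_point[OF ab'(1)] .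
    then obtain t where t: "t \<noteq> 0" "a = t * a'" "b = t * b'" using ab(1) by (rule W_line_eq_imp)
    have "{(c * a, c * b) | c. c \<noteq> 0} = {(c * a', c * b') | c. c \<noteq> 0}"
    proof (intro equalityI subsetI; clarify)
      fix c :: 'k assume "c \<noteq> 0"
      thus "\<exists>d. (c * a, c * b) = (d * a', d * b') \<and> d \<noteq> 0"
        using t by (intro exI[of _ "c * t"]) simp
      show "\<exists>d. (c * a', c * b') = (d * a, d * b) \<and> d \<noteq> 0"
        using t \<open>c \<noteq> 0\<close> by (intro exI[of _ "c / t"]) simp
    qed
    thus "p = q" unfolding ab(2) ab'(2) P1_point_eq[OF ab(1)] P1_point_eq[OF ab'(1)] fst_conv snd_conv .
  qed
  show "W_at ` P1 = (projective_R :: 'k fls set set)"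
  proof (intro equalityI subsetI)
    fix W assume "W \<in> W_at ` (P1 :: ('k \<times> 'k) set set)"
    then obtain p :: "('k \<times> 'k) set" where p: "p \<in> P1" "W = W_at p" by blast
    obtain a b where ab: "(a, b) \<noteq> (0, 0)" "p = P1_point (a, b)" using p(1) by (rule P1_cases)
    show "W \<in> projective_R" unfolding p(2) ab(2) W_at_P1_point[OF ab(1)] projective_R_def using ab(1) by blast
  next
    fix W :: "'k fls set" assume "W \<in> projective_R"
    then obtain a b where ab: "(a, b) \<noteq> (0, 0)" "W = W_line a b" unfolding projective_R_def by blast
    hence "P1_point (a, b) \<in> P1" unfolding P1_eq by blast
    thus "W \<in> W_at ` P1" using W_at_P1_point[OF ab(1)] ab(2) by (metis imageI)
  qed
qed

section \<open>Discontinuity\<close>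

definition affine_point :: "'k::field \<Rightarrow> ('k \<times> 'k) set" where
  "affine_point t = P1_point (t, 1)"

lemma affine_point_eq: "affine_point t = {(c * t, c) | c. c \<noteq> (0 :: 'k::field)}"
  by (simp add: affine_point_def P1_point_eq)

lemma affine_point_in_P1: "affine_point t \<in> P1"
  by (auto simp: affine_point_def P1_eq)

lemma coord_on_P1_affine_point:
  fixes t :: "'k::field_char_0"
  shows "coord_on_P1 (-1) 1 (affine_point t) = (if t = 0 then -1 else 0)"
    and "coord_on_P1 0 1 (affine_point t) = (if t = 0 then 0 else - 1 / t)"
  by (simp_all add: coord_on_P1_def affine_point_def W_at_P1_point sato_gamma_inv_W_line
      line_operator_properties del: One_nat_def)

section \<open>The Zariski topology and regular functions\<close>

lemma binary_form_scale:
  "binary_form d c (k * a, k * b) = k ^ d * binary_form d c (a, b :: 'k::field)"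
  unfolding binary_form_def sum_distrib_left
proof (intro sum.cong refl)
  fix i assume "i \<in> {..d}"
  hence "k ^ d = k ^ i * k ^ (d - i)" by (simp flip: power_add)
  thus "c i * fst (k * a, k * b) ^ i * snd (k * a, k * b) ^ (d - i) =
      k ^ d * (c i * fst (a, b) ^ i * snd (a, b) ^ (d - i))"
    by (simp add: power_mult_distrib mult_ac)
qed

lemma binary_form_affine: "binary_form d c (t, 1) = poly (\<Sum>i\<le>d. monom (c i) i) (t :: 'k::field)"
  by (simp add: binary_form_def poly_sum poly_monom)

text \<open>In the chart a basic open set is the complement of the zeros of a dehomogenized form.
  Being empty or cofinite passes to finite intersections and to unions.\<close>

lemma openin_zariski_P1_affine:
  fixes U :: "('k::field \<times> 'k) set set"
  assumes "openin zariski_P1 U"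
  shows "(\<forall>t. affine_point t \<notin> U) \<or> finite {t. affine_point t \<notin> U}"
  using assms unfolding zariski_P1_def openin_topology_generated_by_iff
proof (induction rule: generate_topology_on.induct)
  case (Int U V)
  have "{t. affine_point t \<notin> U \<inter> V} = {t. affine_point t \<notin> U} \<union> {t. affine_point t \<notin> V}" by auto
  thus ?case using Int.IH by auto
next
  case (UN K)
  show ?case
  proof (cases "\<exists>U\<in>K. \<exists>t. affine_point t \<in> U")
    case True
    then obtain U where U: "U \<in> K" "\<exists>t. affine_point t \<in> U" by blast
    hence "finite {t. affine_point t \<notin> U}" using UN.IH[OF U(1)] by blast
    moreover have "{t. affine_point t \<notin> \<Union>K} \<subseteq> {t. affine_point t \<notin> U}" using U(1) by blast
    ultimately show ?thesis using finite_subset by blast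
  next
    case False
    thus ?thesis by blast
  qed
next
  case (Basis U)
  then obtain d c where U: "U = {p \<in> P1. \<forall>v\<in>p. binary_form d c v \<noteq> 0}" by blast
  define q where "q = (\<Sum>i\<le>d. monom (c i) i)"
  \<comment> \<open>Rescaling multiplies the form by \<open>k ^ d\<close>, so nonvanishing at one
    representative implies it at all of them.\<close>
  have form: "binary_form d c (k * t, k) = k ^ d * poly q t" for k t
    unfolding q_def binary_form_affine[symmetric] binary_form_scale[symmetric] by simp
  have mem: "affine_point t \<in> U \<longleftrightarrow> poly q t \<noteq> 0" for t
  proof
    assume "affine_point t \<in> U"
    moreover have "(1 * t, 1) \<in> affine_point t"
      unfolding affine_point_eq by (intro CollectI exI[of _ 1]) simp
    ultimately have "binary_form d c (1 * t, 1) \<noteq> 0" unfolding U by blast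
    thus "poly q t \<noteq> 0" unfolding form by simp
  next
    assume "poly q t \<noteq> 0"
    hence "binary_form d c v \<noteq> 0" if "v \<in> affine_point t" for v
      using that unfolding affine_point_eq by (auto simp: form)
    thus "affine_point t \<in> U" using affine_point_in_P1 unfolding U by blast
  qed
  show ?case
  proof (cases "q = 0")
    case False
    hence "finite {t. affine_point t \<notin> U}" unfolding mem using poly_roots_finite[of q] by simp
    thus ?thesis ..
  qed (simp add: mem)
qed simp

lemma P1_openin_zariski: "openin zariski_P1 P1"
  unfolding zariski_P1_def
  by (rule topology_generated_by_Basis)
     (auto intro!: exI[of _ 0] exI[of _ "\<lambda>_. 1"] simp: binary_form_def)

lemma topspace_zariski_P1: "topspace zariski_P1 = P1"
proof
  show "topspace zariski_P1 \<subseteq> P1" unfolding zariski_P1_def topology_generated_by_topspace by blast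
qed (rule openin_subset[OF P1_openin_zariski])

text \<open>The preimage of the nonzero scalars meets the chart in the single point
  \<open>t = 0\<close>, which is neither empty nor cofinite.\<close>

lemma not_continuous_zariski_coord:
  "\<not> continuous_map zariski_P1 zariski_A1 (coord_on_P1 (-1) 1 :: ('k::field_char_0 \<times> 'k) set \<Rightarrow> 'k)"
proof
  let ?f = "coord_on_P1 (-1) 1 :: ('k \<times> 'k) set \<Rightarrow> 'k"
  assume cont: "continuous_map zariski_P1 zariski_A1 ?f"
  have "openin zariski_A1 {t :: 'k. poly [:0, 1:] t \<noteq> 0}"
    unfolding zariski_A1_def by (rule topology_generated_by_Basis) blast
  from openin_continuous_map_preimage[OF cont this]
  have "openin zariski_P1 {p \<in> P1. ?f p \<noteq> 0}" by (simp add: topspace_zariski_P1)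
  note * = openin_zariski_P1_affine[OF this]
  have eq: "affine_point t \<in> {p \<in> P1. ?f p \<noteq> 0} \<longleftrightarrow> t = 0" for t
    by (simp add: affine_point_in_P1 coord_on_P1_affine_point del: One_nat_def)
  define Z where "Z = {p \<in> P1. ?f p \<noteq> 0}"
  note * = *[folded Z_def] and eq = eq[folded Z_def]
  have "{t. affine_point t \<notin> Z} = UNIV - {0}" unfolding eq by blast
  hence "finite (UNIV - {0 :: 'k})" using * eq[of 0] by metis
  thus False by (simp add: infinite_UNIV_char_0)
qed

text \<open>A neighbourhood of \<open>(0 : 1)\<close> meets the chart in a cofinite, hence infinite,
  set. Forms become polynomials there, so polynomial identities can be deduced from values of
  \<open>f\<close>.\<close>

lemma regular_on_P1_near_0:
  fixes f :: "('k::field_char_0 \<times> 'k) set \<Rightarrow> 'k"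
  assumes "regular_on_P1 f"
  obtains a b T where "infinite T" "0 \<in> T"
    "\<And>t. t \<in> T \<Longrightarrow> poly b t \<noteq> 0 \<and> f (affine_point t) = poly a t / poly b t"
proof -
  from bspec[OF assms[unfolded regular_on_P1_def] affine_point_in_P1[of 0]]
  obtain U d a b where U: "openin zariski_P1 U" "affine_point 0 \<in> U"
    "\<forall>q\<in>U. \<forall>v\<in>q. binary_form d b v \<noteq> 0 \<and> f q = binary_form d a v / binary_form d b v"
    by iprover
  have "finite {t. affine_point t \<notin> U}" using openin_zariski_P1_affine[OF U(1)] U(2) by blast
  moreover have "{t. affine_point t \<notin> U} \<union> {t. affine_point t \<in> U} = UNIV" by blast
  ultimately have inf: "infinite {t. affine_point t \<in> U}" by (metis finite_UnI infinite_UNIV_char_0)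
  have mem: "(t, 1) \<in> affine_point t" for t :: 'k by (simp add: affine_point_eq)
  have "poly (\<Sum>i\<le>d. monom (b i) i) t \<noteq> 0 \<and>
      f (affine_point t) = poly (\<Sum>i\<le>d. monom (a i) i) t / poly (\<Sum>i\<le>d. monom (b i) i) t"
    if "t \<in> {t. affine_point t \<in> U}" for t
  proof -
    have "affine_point t \<in> U" using that by simp
    from bspec[OF bspec[OF U(3) this] mem[of t]] show ?thesis unfolding binary_form_affine[symmetric] .
  qed
  moreover have "0 \<in> {t. affine_point t \<in> U}" using U(2) by simp
  ultimately show ?thesis by (intro that[OF inf])
qed

lemma poly_eq_on_infinite:
  fixes p q :: "'k::idom poly"
  assumes "infinite T" "\<And>t. t \<in> T \<Longrightarrow> poly p t = poly q t"
  shows "p = q"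
proof (rule ccontr)
  assume "p \<noteq> q"
  hence "finite {t. poly (p - q) t = 0}" by (intro poly_roots_finite) simp
  moreover have "T \<subseteq> {t. poly (p - q) t = 0}" using assms(2) by auto
  ultimately show False using assms(1) finite_subset by blast
qed

lemma not_regular_coord:
  "\<not> regular_on_P1 (coord_on_P1 (-1) 1 :: ('k::field_char_0 \<times> 'k) set \<Rightarrow> 'k)"
  "\<not> regular_on_P1 (coord_on_P1 0 1 :: ('k \<times> 'k) set \<Rightarrow> 'k)"
proof -
  show "\<not> regular_on_P1 (coord_on_P1 (-1) 1 :: ('k \<times> 'k) set \<Rightarrow> 'k)"
  proof
    assume "regular_on_P1 (coord_on_P1 (-1) 1 :: ('k \<times> 'k) set \<Rightarrow> 'k)"
    then obtain a b :: "'k poly" and T where T: "infinite T" "0 \<in> T"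
      "\<And>t. t \<in> T \<Longrightarrow> poly b t \<noteq> 0 \<and> coord_on_P1 (-1) 1 (affine_point t) = poly a t / poly b t"
      by (rule regular_on_P1_near_0) blast
    have "infinite (T - {0})" using T(1) by simp
    moreover have "poly a t = poly 0 t" if "t \<in> T - {0}" for t
      using T(3)[of t] that by (auto simp: coord_on_P1_affine_point simp del: One_nat_def)
    \<comment> \<open>A zero numerator contradicts the value -1 at \<open>t = 0\<close>.\<close>
    ultimately have "a = 0" by (rule poly_eq_on_infinite)
    thus False using T(3)[OF T(2)] by (simp add: coord_on_P1_affine_point del: One_nat_def)
  qed
  show "\<not> regular_on_P1 (coord_on_P1 0 1 :: ('k \<times> 'k) set \<Rightarrow> 'k)"
  proof
    assume "regular_on_P1 (coord_on_P1 0 1 :: ('k \<times> 'k) set \<Rightarrow> 'k)"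
    then obtain a b :: "'k poly" and T where T: "infinite T" "0 \<in> T"
      "\<And>t. t \<in> T \<Longrightarrow> poly b t \<noteq> 0 \<and> coord_on_P1 0 1 (affine_point t) = poly a t / poly b t"
      by (rule regular_on_P1_near_0) blast
    have "infinite (T - {0})" using T(1) by simp
    moreover have "poly (- b) t = poly ([:0, 1:] * a) t" if "t \<in> T - {0}" for t
    proof -
      have *: "t \<noteq> 0" "poly b t \<noteq> 0" "- 1 / t = poly a t / poly b t"
        using T(3)[of t] that by (simp_all add: coord_on_P1_affine_point del: One_nat_def)
      have "- 1 * poly b t = poly a t * t" using *(3) unfolding frac_eq_eq[OF *(1,2)] .
      thus ?thesis by (simp add: mult.commute)
    qed
    \<comment> \<open>The identity forces the denominator to vanish at \<open>t = 0\<close>.\<close>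
    ultimately have "- b = [:0, 1:] * a" by (rule poly_eq_on_infinite)
    hence "poly (- b) 0 = 0" by simp
    thus False using T(3)[OF T(2)] by simp
  qed
qed

section \<open>Nondiscrete field topologies\<close>

lemma topspace_P1_topology:
  assumes "topspace \<tau> = UNIV"
  shows "topspace (P1_topology \<tau>) = P1"
proof
  have "openin (P1_topology \<tau>) P1"
    unfolding openin_P1_topology
  proof
    have "{v \<in> topspace (prod_topology \<tau> \<tau>) - {(0, 0)}. P1_point v \<in> P1} =
        topspace (subtopology (prod_topology \<tau> \<tau>) (UNIV - {(0, 0)}))"
      by (auto simp: P1_eq assms)
    thus "openin (subtopology (prod_topology \<tau> \<tau>) (UNIV - {(0, 0)}))
        {v \<in> topspace (prod_topology \<tau> \<tau>) - {(0, 0)}. P1_point v \<in> P1}"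
      by (simp only: openin_topspace)
  qed simp
  thus "P1 \<subseteq> topspace (P1_topology \<tau>)" by (rule openin_subset)
  show "topspace (P1_topology \<tau>) \<subseteq> P1"
    using openin_topspace[of "P1_topology \<tau>"] unfolding openin_P1_topology by blast
qed

text \<open>The chart is \<open>t \<mapsto> (t, 1)\<close> followed by the quotient map. Composing
  with it reduces discontinuity on the projective line to maps of the field.\<close>

lemma continuous_map_affine_point:
  assumes "topspace \<tau> = UNIV"
  shows "continuous_map \<tau> (P1_topology \<tau>) (affine_point :: 'k::field \<Rightarrow> _)"
  unfolding continuous_map_def topspace_P1_topology[OF assms]
proof (intro conjI allI impI)
  fix U assume "openin (P1_topology \<tau>) U"
  then obtain T where T: "openin (prod_topology \<tau> \<tau>) T"
    "{v \<in> topspace (prod_topology \<tau> \<tau>) - {(0, 0)}. P1_point v \<in> U} = T \<inter> (UNIV - {(0, 0)})"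
    unfolding openin_P1_topology openin_subtopology by blast
  have "continuous_map \<tau> (prod_topology \<tau> \<tau>) (\<lambda>t. (t, 1))"
    by (simp add: continuous_map_paired assms)
  from openin_continuous_map_preimage[OF this T(1)]
  have "openin \<tau> {t. (t, 1) \<in> T}" by (simp add: assms)
  moreover have "(t, 1) \<in> T \<longleftrightarrow> affine_point t \<in> U" for t
    using arg_cong[OF T(2), of "\<lambda>A. (t, 1) \<in> A"] by (simp add: assms affine_point_def)
  ultimately show "openin \<tau> {t \<in> topspace \<tau>. affine_point t \<in> U}" by (simp add: assms)
qed (simp add: affine_point_in_P1)

text \<open>Otherwise translations would make every singleton open.\<close>

lemma nondiscrete_not_openin_0:
  assumes "nondiscrete_field_topology (\<tau> :: 'k::field topology)"
  shows "\<not> openin \<tau> {0}"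
proof
  assume 0: "openin \<tau> {0}"
  have top: "topspace \<tau> = UNIV" and plus: "continuous_map (prod_topology \<tau> \<tau>) \<tau> (\<lambda>(s, t). s + t)"
    using assms by (auto simp: nondiscrete_field_topology_def)
  have "openin \<tau> {s}" for s
  proof -
    have "continuous_map \<tau> (prod_topology \<tau> \<tau>) (\<lambda>t. (t, - s))"
      by (simp add: continuous_map_paired top)
    from continuous_map_compose[OF this plus] have "continuous_map \<tau> \<tau> (\<lambda>t. t - s)"
      by (simp add: o_def)
    from openin_continuous_map_preimage[OF this 0] show ?thesis by (simp add: top)
  qed
  hence "discrete_topology UNIV = \<tau>" by (simp add: discrete_topology_unique top)
  thus False using assms by (simp add: nondiscrete_field_topology_def)
qed

lemma nondiscrete_openin_punctured:
  assumes "nondiscrete_field_topology (\<tau> :: 'k::field topology)"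
  shows "openin \<tau> (UNIV - {s})"
proof -
  have top: "topspace \<tau> = UNIV" and "Hausdorff_space \<tau>"
    using assms by (auto simp: nondiscrete_field_topology_def)
  hence "closedin \<tau> {s}" by (simp add: closedin_Hausdorff_sing_eq)
  thus ?thesis by (simp add: closedin_def top)
qed

lemma not_continuous_coord:
  fixes \<tau> :: "'k::field_char_0 topology"
  assumes \<tau>: "nondiscrete_field_topology \<tau>"
  shows "\<not> continuous_map (P1_topology \<tau>) \<tau> (coord_on_P1 (-1) 1)"
    and "\<not> continuous_map (P1_topology \<tau>) \<tau> (coord_on_P1 0 1)"
proof -
  have top: "topspace \<tau> = UNIV" and times: "continuous_map (prod_topology \<tau> \<tau>) \<tau> (\<lambda>(s, t). s * t)"
    using \<tau> by (auto simp: nondiscrete_field_topology_def)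
  \<comment> \<open>Points are closed, so the preimage of the complement of \<open>s\<close> is
    open; it is \<open>{0}\<close>.\<close>
  have *: False if "continuous_map \<tau> \<tau> g" "\<And>t. g t = s \<longleftrightarrow> t \<noteq> 0" for g s
  proof -
    have "openin \<tau> {t \<in> topspace \<tau>. g t \<in> UNIV - {s}}"
      by (rule openin_continuous_map_preimage[OF that(1) nondiscrete_openin_punctured[OF \<tau>]])
    also have "{t \<in> topspace \<tau>. g t \<in> UNIV - {s}} = {0}" using that(2) by (auto simp: top)
    finally show False using nondiscrete_not_openin_0[OF \<tau>] by simp
  qed
  note affine = continuous_map_affine_point[OF top]
  show "\<not> continuous_map (P1_topology \<tau>) \<tau> (coord_on_P1 (-1) 1)"
  proof
    assume "continuous_map (P1_topology \<tau>) \<tau> (coord_on_P1 (-1) 1)"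
    from continuous_map_compose[OF affine this] show False
      by (rule *[of _ 0]) (simp add: coord_on_P1_affine_point del: One_nat_def)
  qed
  show "\<not> continuous_map (P1_topology \<tau>) \<tau> (coord_on_P1 0 1)"
  proof
    assume "continuous_map (P1_topology \<tau>) \<tau> (coord_on_P1 0 1)"
    \<comment> \<open>The function itself does not isolate 0 by one value, but its product with
      \<open>t\<close> is -1 off 0 and 0 at 0.\<close>
    from continuous_map_compose[OF affine this]
    have "continuous_map \<tau> (prod_topology \<tau> \<tau>) (\<lambda>t. (t, (coord_on_P1 0 1 \<circ> affine_point) t))"
      by (simp add: continuous_map_paired o_def)
    from continuous_map_compose[OF this times] show False
      by (rule *[of _ "-1"]) (simp add: coord_on_P1_affine_point del: One_nat_def)
  qed
qed

text \<open>Parametrizing \<open>R\<close>, applying \<open>\<gamma>^-1\<close> and taking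
  \<open>a_(-1,1)\<close> composes to a function on the projective line that is discontinuous in
  either setting.\<close>

lemma not_continuous_sato_gamma_inv:
  fixes X :: "('k::field_char_0 \<times> 'k) set topology"
  assumes X: "(X = zariski_P1 \<and> \<tau> = zariski_A1) \<or> (nondiscrete_field_topology \<tau> \<and> X = P1_topology \<tau>)"
    and W: "continuous_map X TGr W_at"
    and TE: "continuous_map TE \<tau> (psdo_coord (-1) 1)"
  shows "\<not> continuous_map (subtopology TGr projective_R) TE sato_gamma_inv"
proof
  assume cont: "continuous_map (subtopology TGr projective_R) TE sato_gamma_inv"
  have "topspace X = P1"
    using X topspace_zariski_P1 topspace_P1_topology unfolding nondiscrete_field_topology_def by metis
  moreover have "W_at ` P1 \<subseteq> (projective_R :: 'k fls set set)"
    by (rule equalityD1[OF bij_betw_imp_surj_on[OF bij_betw_W_at]])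
  ultimately have "continuous_map X (subtopology TGr projective_R) W_at"
    using W by (simp add: continuous_map_in_subtopology image_subset_iff_funcset)
  from continuous_map_compose[OF continuous_map_compose[OF this cont] TE]
  have "continuous_map X \<tau> (coord_on_P1 (-1) 1)"
    by (simp add: o_def coord_on_P1_def[abs_def])
  thus False using X not_continuous_zariski_coord not_continuous_coord(1) by metis
qed

theorem mainTheorem4:
  shows
    "(projective_R :: 'k::field_char_0 fls set set) \<subseteq> Gr0 \<and>
     (\<forall>\<alpha> \<beta> :: 'k. (\<alpha>, \<beta>) \<noteq> (0, 0) \<longrightarrow> W_at (P1_point (\<alpha>, \<beta>)) = W_line \<alpha> \<beta>) \<and>
     bij_betw W_at P1 (projective_R :: 'k fls set set) \<and>
     (\<forall>W \<in> (projective_R :: 'k fls set set). \<exists>!S. S \<in> quasiregular \<and> sato_gamma S = W) \<and>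
     (\<forall>\<alpha> \<beta> :: 'k. (\<alpha>, \<beta>) \<noteq> (0, 0) \<longrightarrow>
        psdo_coord (-1) 1 (sato_gamma_inv (W_line \<alpha> \<beta>)) = (if \<alpha> \<noteq> 0 then 0 else -1) \<and>
        psdo_coord 0 1 (sato_gamma_inv (W_line \<alpha> \<beta>)) = (if \<alpha> \<noteq> 0 then - \<beta> / \<alpha> else 0)) \<and>
     (\<forall>\<tau> :: 'k topology. nondiscrete_field_topology \<tau> \<longrightarrow>
        \<not> continuous_map (P1_topology \<tau>) \<tau> (coord_on_P1 (-1) 1) \<and>
        \<not> continuous_map (P1_topology \<tau>) \<tau> (coord_on_P1 0 1)) \<and>
     \<not> continuous_map zariski_P1 zariski_A1 (coord_on_P1 (-1) 1 :: ('k \<times> 'k) set \<Rightarrow> 'k) \<and>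
     \<not> regular_on_P1 (coord_on_P1 (-1) 1 :: ('k \<times> 'k) set \<Rightarrow> 'k) \<and>
     \<not> regular_on_P1 (coord_on_P1 0 1 :: ('k \<times> 'k) set \<Rightarrow> 'k) \<and>
     (\<forall>(X :: ('k \<times> 'k) set topology) \<tau> TGr TE.
        ((X = zariski_P1 \<and> \<tau> = zariski_A1) \<or>
         (nondiscrete_field_topology \<tau> \<and> X = P1_topology \<tau>)) \<and>
        topspace TGr = Gr0 \<and> continuous_map X TGr W_at \<and>
        topspace TE = monic0 \<and>
        (\<forall>i j. j \<ge> 1 \<longrightarrow> continuous_map TE \<tau> (psdo_coord i j)) \<longrightarrow>
        \<not> continuous_map (subtopology TGr projective_R) TE sato_gamma_inv \<and>
        \<not> continuous_map TGr TE sato_gamma_inv)"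
proof -
  \<comment> \<open>The explicit operator gives existence, injectivity of \<open>\<gamma>\<close>
    gives uniqueness.\<close>
  have unique: "\<exists>!S. S \<in> quasiregular \<and> sato_gamma S = W" if W: "W \<in> projective_R" for W :: "'k fls set"
  proof -
    obtain a b where ab: "(a, b) \<noteq> (0, 0)" "W = W_line a b"
      using W unfolding projective_R_def mem_Collect_eq by iprover
    note S = line_operator_properties(1,2)[OF ab(1)]
    show ?thesis
    proof (rule ex1I)
      show "line_operator a b \<in> quasiregular \<and> sato_gamma (line_operator a b) = W"
        using S ab(2) by (intro conjI) simp_all
      fix T assume "T \<in> quasiregular \<and> sato_gamma T = W"
      hence T: "T \<in> quasiregular" "sato_gamma T = sato_gamma (line_operator a b)"
        unfolding S(2) ab(2) by iprover+
      show "T = line_operator a b" by (rule inj_onD[OF sato_gamma_inj T(2,1) S(1)])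
    qed
  qed
  have "(projective_R :: 'k fls set set) \<subseteq> Gr0"
  proof
    fix W :: "'k fls set" assume "W \<in> projective_R"
    then obtain a b where ab: "(a, b) \<noteq> (0, 0)" "W = W_line a b"
      unfolding projective_R_def mem_Collect_eq by iprover
    show "W \<in> Gr0" unfolding ab(2) by (rule W_line_in_Gr0[OF ab(1)])
  qed
  moreover have "psdo_coord (-1) 1 (sato_gamma_inv (W_line \<alpha> \<beta>)) = (if \<alpha> \<noteq> 0 then 0 else -1) \<and>
      psdo_coord 0 1 (sato_gamma_inv (W_line \<alpha> \<beta>)) = (if \<alpha> \<noteq> 0 then - \<beta> / \<alpha> else 0)"
    if "(\<alpha>, \<beta>) \<noteq> (0, 0)" for \<alpha> \<beta> :: 'k
    unfolding sato_gamma_inv_W_line[OF that]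
    by (intro conjI line_operator_properties(3,4)[OF that])
  moreover have "\<not> continuous_map (subtopology TGr projective_R) TE sato_gamma_inv \<and>
      \<not> continuous_map TGr TE sato_gamma_inv"
    if that: "((X = zariski_P1 \<and> \<tau> = zariski_A1) \<or> (nondiscrete_field_topology \<tau> \<and> X = P1_topology \<tau>)) \<and>
        topspace TGr = Gr0 \<and> continuous_map X TGr W_at \<and> topspace TE = monic0 \<and>
        (\<forall>i j. j \<ge> 1 \<longrightarrow> continuous_map TE \<tau> (psdo_coord i j))"
    for X :: "('k \<times> 'k) set topology" and \<tau> TGr TE
  proof -
    have X: "(X = zariski_P1 \<and> \<tau> = zariski_A1) \<or> (nondiscrete_field_topology \<tau> \<and> X = P1_topology \<tau>)"
      using that by (rule conjunct1)
    have "continuous_map X TGr W_at" "continuous_map TE \<tau> (psdo_coord (-1) 1)" using that by simp_all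
    from not_continuous_sato_gamma_inv[OF X this]
    \<comment> \<open>Continuity on the whole Grassmannian would restrict to
      \<open>R\<close>.\<close>
    show ?thesis using continuous_map_from_subtopology[of TGr TE sato_gamma_inv projective_R] by iprover
  qed
  ultimately show ?thesis
    apply (intro conjI)
    subgoal by assumption
    subgoal by (intro allI impI W_at_P1_point)
    subgoal by (rule bij_betw_W_at)
    subgoal by (intro ballI unique)
    subgoal by iprover
    subgoal by (intro allI impI conjI not_continuous_coord)
    subgoal by (rule not_continuous_zariski_coord)
    subgoal by (rule not_regular_coord)
    subgoal by (rule not_regular_coord)
    subgoal by iprover
    done
qed

end
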